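(* Let $d \ge 1$ be an integer and let $\alpha \in (0,2)$. There exists a constant $c > 0$, depending only on $d$ and $\alpha$, such that for every nonempty open and bounded set $D \subseteq \mathbf{R}^d$ (not necessarily connected, and with no regularity assumption on its boundary) the following holds. Let $\varphi_1$ be the ground state eigenfunction of the Dirichlet fractional Laplacian $\Delta^{\frac{\alpha}{2}}$ on $D$, positive on $D$ and normalized by $\|\varphi_1\|_{L^2(D)} = 1$, and let $-\lambda_1$ be the corresponding (greatest) eigenvalue. Then $$\sup_{x \in D} \varphi_1(x) \le c \, (\lambda_1)^{\frac{d}{2\alpha}}.$$
   Context: For $\alpha \in (0,2)$ the fractional Laplacian $\Delta^{\frac{\alpha}{2}} = -(-\Delta)^{\frac{\alpha}{2}}$ on $\mathbf{R}^d$ is given, for $f \in C_c^\infty(\mathbf{R}^d)$, by $$\Delta^{\frac{\alpha}{2}} f(x) = \frac{2^\alpha \, \Gamma(\frac{d+\alpha}{2})}{\pi^{\frac{d}{2}} \, |\Gamma(-\frac{\alpha}{2})|} \lim_{\varepsilon \searrow 0} \int_{\mathbf{R}^d \setminus B(x,\varepsilon)} \frac{f(y) - f(x)}{|y-x|^{d+\alpha}} \, dy ;$$ equivalently, it is the Fourier multiplier with symbol $-|z|^\alpha$, the generator of the isotropic $\alpha$-stable Lévy process $X(t)$ with $\mathbf{E}_0 \exp(-i\langle z, X(t)\rangle) = \exp(-t|z|^\alpha)$. For a nonempty open bounded set $D \subseteq \mathbf{R}^d$, the Dirichlet fractional Laplacian on $D$ is the negative of the Friedrichs extension, in $L^2(D)$,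 of the nonnegative symmetric operator mapping $f \in C_c^\infty(D)$ (extended by $0$ outside $D$) to $(-\Delta^{\frac{\alpha}{2}} f)\mathbf{1}_D$. It is the generator of the process $X(t)$ killed upon exiting $D$. It is known that this operator has an orthonormal family of eigenfunctions $\varphi_n \in L^2(D)$, $n = 1, 2, \dots$, corresponding to a nonincreasing sequence of negative eigenvalues $(-\lambda_n)$ (counted with multiplicity), so $0 < \lambda_1 \le \lambda_2 \le \dots$. All eigenfunctions are (taken to be) continuous on $D$ and are bounded. The first eigenvalue $-\lambda_1$ is simple, and the corresponding eigenfunction $\varphi_1$, called the ground state eigenfunction, may be chosen positive on $D$. *)

theory Defs
  imports "HOL-Analysis.Analysis"
begin

primrec C_k :: "nat \<Rightarrow> ('a::euclidean_space \<Rightarrow> real) \<Rightarrow> bool" where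
  "C_k 0 f \<longleftrightarrow> continuous_on UNIV f"
| "C_k (Suc k) f \<longleftrightarrow>
     (\<forall>x. f differentiable (at x)) \<and> (\<forall>v. C_k k (\<lambda>x. frechet_derivative f (at x) v))"

text \<open>Functions on an open set \<open>D\<close> of class \<open>C\<^sub>c\<^sup>\<infinity>\<close> are taken extended by zero to the whole space.\<close>

definition test_functions :: "'a::euclidean_space set \<Rightarrow> ('a \<Rightarrow> real) set" where
  "test_functions D =
     {f. (\<forall>k. C_k k f) \<and> compact (closure {x. f x \<noteq> 0}) \<and> closure {x. f x \<noteq> 0} \<subseteq> D}"

definition frac_laplacian :: "real \<Rightarrow> ('a::euclidean_space \<Rightarrow> real) \<Rightarrow> 'a \<Rightarrow> real" where
  "frac_laplacian \<alpha> f x =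
     2 powr \<alpha> * Gamma ((real DIM('a) + \<alpha>) / 2) / (pi powr (real DIM('a) / 2) * \<bar>Gamma (- \<alpha> / 2)\<bar>) *
     Lim (at_right 0)
       (\<lambda>\<epsilon>. LINT y:(- ball x \<epsilon>)|lborel. (f y - f x) / norm (y - x) powr (real DIM('a) + \<alpha>))"

text \<open>Elements of the real Hilbert space \<open>L\<^sup>2(D)\<close> are represented by functions on the whole space;
  values outside \<open>D\<close> and on null sets are irrelevant. Operators on \<open>L\<^sup>2(D)\<close> are represented by
  their graphs, which are closed under almost everywhere equality on \<open>D\<close>.\<close>

definition L2 :: "'a::euclidean_space set \<Rightarrow> ('a \<Rightarrow> real) set" where
  "L2 D = {f. set_borel_measurable lborel D f \<and> set_integrable lborel D (\<lambda>x. (f x)\<^sup>2)}"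

definition L2_inner :: "'a::euclidean_space set \<Rightarrow> ('a \<Rightarrow> real) \<Rightarrow> ('a \<Rightarrow> real) \<Rightarrow> real" where
  "L2_inner D f g = (LINT x:D|lborel. f x * g x)"

definition L2_norm :: "'a::euclidean_space set \<Rightarrow> ('a \<Rightarrow> real) \<Rightarrow> real" where
  "L2_norm D f = sqrt (L2_inner D f f)"

text \<open>Let \<open>A\<close> be a nonnegative symmetric operator on \<open>L\<^sup>2(D)\<close> with domain \<open>Q\<close>. The sequences below are
  those in \<open>Q\<close> that converge to \<open>f\<close> in \<open>L\<^sup>2(D)\<close> and are Cauchy for the form
  \<open>q(u, v) = \<langle>A u, v\<rangle>\<close>; the limits \<open>f\<close> make up the domain of the closure of \<open>q\<close>.\<close>

definition form_approx ::
  "'a::euclidean_space set \<Rightarrow> ('a \<Rightarrow> real) set \<Rightarrow> (('a \<Rightarrow> real) \<Rightarrow> 'a \<Rightarrow> real) \<Rightarrow>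
     (nat \<Rightarrow> 'a \<Rightarrow> real) \<Rightarrow> ('a \<Rightarrow> real) \<Rightarrow> bool" where
  "form_approx D Q A u f \<longleftrightarrow>
     (\<forall>n. u n \<in> Q) \<and>
     (\<lambda>n. L2_norm D (\<lambda>x. u n x - f x)) \<longlonglongrightarrow> 0 \<and>
     (\<forall>e>0. \<exists>N. \<forall>m\<ge>N. \<forall>n\<ge>N.
        L2_inner D (A (\<lambda>x. u m x - u n x)) (\<lambda>x. u m x - u n x) < e)"

text \<open>The Friedrichs extension is the operator associated with the closure of \<open>q\<close>: it maps \<open>f\<close> to \<open>h\<close>
  if \<open>f\<close> is in the domain of the closed form and the value of the closed form at \<open>(f, g)\<close>, that is
  the limit of \<open>q(u n, v n)\<close> along approximating sequences, is \<open>\<langle>h, g\<rangle>\<close> for all \<open>g\<close> in that domain.\<close>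

definition friedrichs_extension ::
  "'a::euclidean_space set \<Rightarrow> ('a \<Rightarrow> real) set \<Rightarrow> (('a \<Rightarrow> real) \<Rightarrow> 'a \<Rightarrow> real) \<Rightarrow>
     (('a \<Rightarrow> real) \<times> ('a \<Rightarrow> real)) set" where
  "friedrichs_extension D Q A =
     {(f, h). f \<in> L2 D \<and> h \<in> L2 D \<and> (\<exists>u. form_approx D Q A u f) \<and>
        (\<forall>g\<in>L2 D. \<forall>u v. form_approx D Q A u f \<longrightarrow> form_approx D Q A v g \<longrightarrow>
           (\<lambda>n. L2_inner D (A (u n)) (v n)) \<longlonglongrightarrow> L2_inner D h g)}"

definition dirichlet_frac_laplacian ::
  "real \<Rightarrow> 'a::euclidean_space set \<Rightarrow> (('a \<Rightarrow> real) \<times> ('a \<Rightarrow> real)) set" where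
  "dirichlet_frac_laplacian \<alpha> D =
     {(f, h). (f, \<lambda>x. - h x) \<in> friedrichs_extension D (test_functions D)
                                (\<lambda>f x. - frac_laplacian \<alpha> f x * indicator D x)}"

definition eigenfunction ::
  "'a::euclidean_space set \<Rightarrow> (('a \<Rightarrow> real) \<times> ('a \<Rightarrow> real)) set \<Rightarrow> real \<Rightarrow> ('a \<Rightarrow> real) \<Rightarrow> bool" where
  "eigenfunction D T \<mu> f \<longleftrightarrow>
     (f, \<lambda>x. \<mu> * f x) \<in> T \<and> \<not> (AE x in lborel. x \<in> D \<longrightarrow> f x = 0)"

definition eigenvalue ::
  "'a::euclidean_space set \<Rightarrow> (('a \<Rightarrow> real) \<times> ('a \<Rightarrow> real)) set \<Rightarrow> real \<Rightarrow> bool" where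
  "eigenvalue D T \<mu> \<longleftrightarrow> (\<exists>f. eigenfunction D T \<mu> f)"

definition ground_state ::
  "real \<Rightarrow> 'a::euclidean_space set \<Rightarrow> real \<Rightarrow> ('a \<Rightarrow> real) \<Rightarrow> bool" where
  "ground_state \<alpha> D lam \<phi> \<longleftrightarrow>
     eigenfunction D (dirichlet_frac_laplacian \<alpha> D) (- lam) \<phi> \<and>
     (\<forall>\<mu>. eigenvalue D (dirichlet_frac_laplacian \<alpha> D) \<mu> \<longrightarrow> \<mu> \<le> - lam) \<and>
     continuous_on D \<phi> \<and> (\<forall>x\<in>D. 0 < \<phi> x) \<and> L2_norm D \<phi> = 1"

end

theory Submission
  imports Defs
begin

text \<open>
  The bound rests on De Giorgi's truncation argument, driven by a Faber--Krahn inequality that is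
  almost immediate for a nonlocal form. Up to a constant, the quadratic form of the Dirichlet
  fractional Laplacian is the double integral of \<open>(v x - v y)\<^sup>2 / norm (x - y) powr (d + \<alpha>)\<close>. If \<open>v\<close> vanishes
  outside a set of measure \<open>a\<close>, the pairs with \<open>x\<close> in this set and \<open>y\<close> outside it already contribute at
  least a constant times \<open>a powr (- \<alpha> / d)\<close> times the square of the \<open>L\<^sup>2\<close> norm of \<open>v\<close>
  (\<open>dirichlet_form_faber_krahn\<close>).

  Testing the eigenvalue equation for \<open>\<phi>\<close> with a truncation \<open>F\<close>, the image of \<open>\<phi> - k\<close> under a monotone
  contraction that resembles the positive part, gives an inequality of the form
  \<open>\<kappa> * a powr (- \<alpha> / d) * \<integral> F\<^sup>2 \<le> lam * \<integral> \<phi> * F\<close> with \<open>a\<close> the measure of a superlevel set of \<open>\<phi>\<close>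
  (\<open>eigenfunction_truncation_inequality\<close>). Once \<open>a\<close> is below a threshold proportional to
  \<open>lam powr (- d / \<alpha>)\<close>, the part of the right-hand side that is quadratic in \<open>F\<close> is absorbed, and the
  measures of the superlevel sets satisfy a recursive inequality with exponent \<open>1 + 2 * \<alpha> / d > 1\<close>
  (\<open>superlevel_decay\<close>). Iterated along the levels \<open>K * (2 - 2 ^ (- n))\<close>, it shows that \<open>\<phi> \<le> 2 * K\<close> almost
  everywhere (\<open>superlevel_null\<close>). By Chebyshev's inequality and the normalization of \<open>\<phi>\<close>, the measure at the first
  level is at most \<open>1 / K\<^sup>2\<close>, so that \<open>K\<close> may be a multiple of \<open>lam powr (d / (2 * \<alpha>))\<close>.

  The connection with the Friedrichs extension is made through test functions only. The truncation
  \<open>soft_cut\<close> is smooth, so it maps test functions to test functions; it is applied to the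
  functions \<open>u n\<close> that approximate \<open>\<phi>\<close> in the form norm, and the truncations converge in \<open>L\<^sup>2\<close>.
  The identity between the operator and its form is obtained from kernels truncated near the diagonal (\<open>truncated_energy_parts\<close>, \<open>dirichlet_form_limit\<close>).\<close>

section \<open>Integrability of the jump kernel\<close>

text \<open>Comparison with multiples of indicators of balls, whose volumes are known, takes the place of an
  integration in polar coordinates.\<close>

lemma integrable_by_balls:
  fixes g :: "'a::euclidean_space \<Rightarrow> real"
  assumes g [measurable]: "g \<in> borel_measurable borel" and g0: "\<And>z. 0 \<le> g z"
    and c0: "\<And>k. 0 \<le> c k" and r0: "\<And>k. 0 \<le> r k"
    and dom: "\<And>z. g z \<noteq> 0 \<Longrightarrow> \<exists>k. norm z < r k \<and> g z \<le> c k"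
    and sm: "summable (\<lambda>k. c k * r k ^ DIM('a))"
  shows "integrable lborel g"
proof -
  have "(\<integral>\<^sup>+z. ennreal (g z) \<partial>lborel)
      \<le> (\<integral>\<^sup>+z. (\<Sum>k. ennreal (c k) * indicator (ball (0::'a) (r k)) z) \<partial>lborel)"
  proof (rule nn_integral_mono)
    fix z :: 'a
    show "ennreal (g z) \<le> (\<Sum>k. ennreal (c k) * indicator (ball 0 (r k)) z)"
    proof (cases "g z = 0")
      case False
      then obtain k where k: "norm z < r k" "g z \<le> c k" using dom by blast
      have "ennreal (g z) \<le> ennreal (c k) * indicator (ball 0 (r k)) z"
        using k by (simp add: ennreal_leI)
      also have "\<dots> \<le> (\<Sum>k. ennreal (c k) * indicator (ball 0 (r k)) z)"
      proof -
        have "sum f {k} \<le> suminf f" for f :: "nat \<Rightarrow> ennreal"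
          by (rule sum_le_suminf) auto
        then show ?thesis by simp
      qed
      finally show ?thesis .
    qed simp
  qed
  also have "\<dots> = (\<Sum>k. \<integral>\<^sup>+z. ennreal (c k) * indicator (ball (0::'a) (r k)) z \<partial>lborel)"
    by (rule nn_integral_suminf)
      (intro borel_measurable_times_ennreal borel_measurable_const borel_measurable_indicator; simp)
  also have "\<dots> = (\<Sum>k. ennreal (unit_ball_vol DIM('a) * (c k * r k ^ DIM('a))))"
  proof (rule arg_cong[where f=suminf], rule ext)
    fix k
    have "emeasure lborel (ball (0::'a) (r k)) = ennreal (unit_ball_vol DIM('a) * r k ^ DIM('a))"
      using r0[of k] by (rule emeasure_ball)
    then show "(\<integral>\<^sup>+z. ennreal (c k) * indicator (ball (0::'a) (r k)) z \<partial>lborel) =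
        ennreal (unit_ball_vol DIM('a) * (c k * r k ^ DIM('a)))"
      using c0[of k] r0[of k]
      by (simp add: nn_integral_cmult_indicator ennreal_mult' [symmetric] mult.left_commute)
  qed
  also have "\<dots> = ennreal (\<Sum>k. unit_ball_vol DIM('a) * (c k * r k ^ DIM('a)))"
    by (rule suminf_ennreal_eq) (auto intro!: mult_nonneg_nonneg c0 r0 zero_le_power sm
        summable_sums summable_mult)
  also have "\<dots> < \<infinity>" by simp
  finally show ?thesis
    using g0 by (intro integrableI_bounded) auto
qed

text \<open>The value at \<open>0\<close> is \<open>0\<close>, since \<open>0 powr p = 0\<close>; this agrees with the convention \<open>a / 0 = 0\<close> in the
  definition of the fractional Laplacian.\<close>

definition riesz_kernel :: "real \<Rightarrow> 'a::euclidean_space \<Rightarrow> real" where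
  "riesz_kernel \<alpha> z = norm z powr - (real DIM('a) + \<alpha>)"

lemma riesz_kernel_measurable [measurable]: "riesz_kernel \<alpha> \<in> borel_measurable borel"
  unfolding riesz_kernel_def by measurable

lemma riesz_kernel_nonneg [simp]: "0 \<le> riesz_kernel \<alpha> z"
  by (simp add: riesz_kernel_def)

lemma riesz_kernel_minus [simp]: "riesz_kernel \<alpha> (- z) = riesz_kernel \<alpha> z"
  by (simp add: riesz_kernel_def)

lemma dyadic_scale:
  fixes t :: real
  assumes "1 \<le> t"
  obtains k :: nat where "2 ^ k \<le> t" "t < 2 * 2 ^ k"
proof -
  define k where "k = nat \<lfloor>log 2 t\<rfloor>"
  have l0: "0 \<le> log 2 t" using assms by simp
  have 1: "real k \<le> log 2 t" "log 2 t < real k + 1"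
    using l0 unfolding k_def by linarith+
  have t: "2 powr (log 2 t) = t" using assms by simp
  have "2 powr real k \<le> t" using powr_mono[OF 1(1), of 2] t by simp
  moreover have "t < 2 powr (real k + 1)" using powr_less_mono[OF 1(2), of 2] t by simp
  ultimately show ?thesis
    by (intro that[of k]) (simp_all add: powr_add powr_realpow)
qed

text \<open>On the dyadic shell of radius \<open>2 ^ k\<close> the kernel contributes of the order of \<open>2 powr (- \<alpha> k)\<close>,
  which is summable at infinity because \<open>\<alpha> > 0\<close>. At the origin, the factor \<open>(norm z)\<^sup>2\<close> turns the
  contribution of radius \<open>2 ^ (- k)\<close> into \<open>2 powr ((\<alpha> - 2) k)\<close>, which is summable because \<open>\<alpha> < 2\<close>.\<close>

lemma integrable_levy_measure:
  assumes "0 < \<alpha>" "\<alpha> < 2"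
  shows "integrable lborel (\<lambda>z::'a::euclidean_space. min 1 ((norm z)\<^sup>2) * riesz_kernel \<alpha> z)"
proof -
  let ?p = "real DIM('a) + \<alpha>"
  let ?g = "\<lambda>z::'a. min 1 ((norm z)\<^sup>2) * riesz_kernel \<alpha> z"
  have p0: "0 < ?p" using assms by simp
  have far: "integrable lborel (\<lambda>z. ?g z * indicator {z. 1 \<le> norm z} z)"
  proof (rule integrable_by_balls[where c="\<lambda>k. (2 powr - ?p) ^ k" and r="\<lambda>k. 2 * 2 ^ k"])
    show "summable (\<lambda>k. (2 powr - ?p) ^ k * (2 * 2 ^ k) ^ DIM('a))"
    proof -
      have "(2 powr - ?p) ^ k * (2 * 2 ^ k) ^ DIM('a) = 2 ^ DIM('a) * (2 powr - \<alpha>) ^ k" for k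
      proof -
        have "(2 powr - ?p) ^ k * (2 ^ k) ^ DIM('a) = (2 powr - \<alpha>) ^ k"
          by (simp add: powr_realpow[symmetric] powr_powr powr_add[symmetric] algebra_simps)
        then show ?thesis by (simp add: power_mult_distrib)
      qed
      moreover have "norm (2 powr - \<alpha>) < (1::real)"
        using assms by (simp add: powr_less_one)
      ultimately show ?thesis
        by (simp only:) (intro summable_mult summable_geometric)
    qed
  next
    fix z :: 'a
    assume "?g z * indicator {z. 1 \<le> norm z} z \<noteq> 0"
    then have z: "1 \<le> norm z" by (auto simp: indicator_def split: if_splits)
    then obtain k where k: "2 ^ k \<le> norm z" "norm z < 2 * 2 ^ k" by (rule dyadic_scale)
    have "?g z = norm z powr - ?p" using z by (simp add: min_def riesz_kernel_def)
    also have "\<dots> \<le> (2 ^ k) powr - ?p" using k p0 by (intro powr_mono2') auto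
    also have "\<dots> = (2 powr - ?p) ^ k"
      by (simp add: powr_realpow[symmetric] powr_powr mult.commute)
    finally show "\<exists>k. norm z < 2 * 2 ^ k \<and>
        ?g z * indicator {z. 1 \<le> norm z} z \<le> (2 powr - ?p) ^ k"
      using k z by auto
  qed auto
  have near: "integrable lborel (\<lambda>z. ?g z * indicator {z. norm z < 1} z)"
  proof (rule integrable_by_balls[where c="\<lambda>k. ((1/2)^k)\<^sup>2 * (2 powr ?p * (2 powr ?p) ^ k)"
        and r="\<lambda>k. 2 * (1/2) ^ k"])
    show "summable (\<lambda>k. ((1/2)^k)\<^sup>2 * (2 powr ?p * (2 powr ?p) ^ k) * (2 * (1/2) ^ k) ^ DIM('a))"
    proof -
      have "((1/2)^k)\<^sup>2 * (2 powr ?p * (2 powr ?p) ^ k) * (2 * (1/2) ^ k) ^ DIM('a) =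
          2 powr ?p * 2 ^ DIM('a) * (2 powr (\<alpha> - 2)) ^ k" for k
      proof -
        have h: "(1/2::real)^k = 2 powr (- real k)"
          by (simp add: powr_minus powr_realpow power_one_over field_simps)
        have "((1/2)^k)\<^sup>2 * (2 powr ?p) ^ k * ((1/2) ^ k) ^ DIM('a) = (2 powr (\<alpha> - 2)) ^ k"
          unfolding h
          by (simp add: powr_realpow[symmetric] powr_powr powr_add[symmetric] algebra_simps
               del: powr_numeral)
        then show ?thesis by (simp add: power_mult_distrib)
      qed
      moreover have "norm (2 powr (\<alpha> - 2)) < (1::real)"
        using assms by (simp add: powr_less_one)
      ultimately show ?thesis
        by (simp only:) (intro summable_mult summable_geometric)
    qed
  next
    fix z :: 'a
    assume nz: "?g z * indicator {z. norm z < 1} z \<noteq> 0"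
    then have z: "norm z < 1" "norm z > 0" by (auto simp: indicator_def split: if_splits)
    then have "1 \<le> 1 / norm z" by simp
    then obtain k where k: "2 ^ k \<le> 1 / norm z" "1 / norm z < 2 * 2 ^ k" by (rule dyadic_scale)
    have up: "norm z \<le> (1/2)^k" and lo: "(1/2)^k / 2 < norm z"
      using k z by (auto simp: field_simps power_one_over)
    have "norm z powr - ?p \<le> ((1/2)^k / 2) powr - ?p"
      using lo p0 by (intro powr_mono2') auto
    also have "(1/2)^k / 2 = (2::real) powr (- (real k + 1))"
      by (simp only: powr_minus powr_add powr_realpow powr_one power_one_over) (simp add: field_simps)
    also have "(2 powr (- (real k + 1))) powr - ?p = 2 powr ?p * (2 powr ?p) ^ k"
      by (simp add: powr_realpow[symmetric] powr_powr powr_add[symmetric] algebra_simps)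
    finally have 1: "riesz_kernel \<alpha> z \<le> 2 powr ?p * (2 powr ?p) ^ k" by (simp add: riesz_kernel_def)
    have "(norm z)\<^sup>2 \<le> ((1/2)^k)\<^sup>2" using up by (intro power_mono) auto
    then have "?g z \<le> ((1/2)^k)\<^sup>2 * (2 powr ?p * (2 powr ?p) ^ k)"
      using 1 by (intro mult_mono min.coboundedI2) auto
    moreover have "norm z < 2 * (1/2)^k" using up by (rule order.strict_trans1) simp
    ultimately show "\<exists>k. norm z < 2 * (1/2) ^ k \<and> ?g z * indicator {z. norm z < 1} z
        \<le> ((1/2)^k)\<^sup>2 * (2 powr ?p * (2 powr ?p) ^ k)"
      using z by auto
  qed auto
  have "integrable lborel (\<lambda>z. ?g z * indicator {z. 1 \<le> norm z} z + ?g z * indicator {z. norm z < 1} z)"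
    using far near by (rule Bochner_Integration.integrable_add)
  moreover have "?g z * indicator {z. 1 \<le> norm z} z + ?g z * indicator {z. norm z < 1} z = ?g z" for z
    by (auto simp: indicator_def)
  ultimately show ?thesis by simp
qed

definition truncated_kernel :: "real \<Rightarrow> real \<Rightarrow> 'a::euclidean_space \<Rightarrow> real" where
  "truncated_kernel \<alpha> \<epsilon> z = indicator (- ball 0 \<epsilon>) z * riesz_kernel \<alpha> z"

lemma truncated_kernel_measurable [measurable]: "truncated_kernel \<alpha> \<epsilon> \<in> borel_measurable borel"
  unfolding truncated_kernel_def by measurable

lemma truncated_kernel_nonneg [simp]: "0 \<le> truncated_kernel \<alpha> \<epsilon> z"
  by (simp add: truncated_kernel_def)

lemma truncated_kernel_minus [simp]: "truncated_kernel \<alpha> \<epsilon> (- z) = truncated_kernel \<alpha> \<epsilon> z"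
  by (simp add: truncated_kernel_def indicator_def)

lemma integrable_truncated_kernel:
  assumes "0 < \<alpha>" "\<alpha> < 2" "0 < \<epsilon>"
  shows "integrable lborel (truncated_kernel \<alpha> \<epsilon> :: 'a::euclidean_space \<Rightarrow> real)"
proof (rule Bochner_Integration.integrable_bound)
  show "integrable lborel (\<lambda>z::'a. inverse (min 1 (\<epsilon>\<^sup>2)) * (min 1 ((norm z)\<^sup>2) * riesz_kernel \<alpha> z))"
    using integrable_levy_measure[OF assms(1,2)] by (rule integrable_mult_right)
  show "AE z in lborel. norm (truncated_kernel \<alpha> \<epsilon> z)
      \<le> norm (inverse (min 1 (\<epsilon>\<^sup>2)) * (min 1 ((norm z)\<^sup>2) * riesz_kernel \<alpha> (z::'a)))"
  proof (rule AE_I2)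
    fix z :: 'a
    show "norm (truncated_kernel \<alpha> \<epsilon> z)
      \<le> norm (inverse (min 1 (\<epsilon>\<^sup>2)) * (min 1 ((norm z)\<^sup>2) * riesz_kernel \<alpha> z))"
    proof (cases "norm z < \<epsilon>")
      case False
      then have "\<epsilon>\<^sup>2 \<le> (norm z)\<^sup>2" using assms by (intro power_mono) auto
      then have "min 1 (\<epsilon>\<^sup>2) \<le> min 1 ((norm z)\<^sup>2)" by auto
      then have "1 \<le> inverse (min 1 (\<epsilon>\<^sup>2)) * min 1 ((norm z)\<^sup>2)"
        using assms by (simp add: field_simps)
      from mult_right_mono[OF this riesz_kernel_nonneg[of \<alpha> z]] False show ?thesis
        by (simp add: truncated_kernel_def abs_mult mult.assoc)
    qed (simp add: truncated_kernel_def)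
  qed
qed (simp add: measurable_lborel1)

section \<open>Calculus of the class of smooth functions\<close>

lemma C_k_SucI:
  assumes "\<And>x. (f has_derivative f' x) (at x)" "\<And>v. C_k k (\<lambda>x. f' x v)"
  shows "C_k (Suc k) f"
proof -
  have "frechet_derivative f (at x) = f' x" for x
    using frechet_derivative_at[OF assms(1)[of x]] by simp
  moreover have "f differentiable (at x)" for x
    using assms(1) by (rule differentiableI)
  ultimately show ?thesis using assms(2) by simp
qed

lemma C_k_Suc_has_derivative:
  "C_k (Suc k) f \<Longrightarrow> (f has_derivative frechet_derivative f (at x)) (at x)"
  by (simp add: frechet_derivative_works)

lemma C_k_Suc_derivative: "C_k (Suc k) f \<Longrightarrow> C_k k (\<lambda>x. frechet_derivative f (at x) v)"
  by simp

lemma C_k_SucD: "C_k (Suc k) f \<Longrightarrow> C_k k f"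
proof (induction k arbitrary: f)
  case 0
  then show ?case
    by (auto intro!: continuous_at_imp_continuous_on differentiable_imp_continuous_within)
next
  case (Suc k)
  show ?case
    by (rule C_k_SucI[OF C_k_Suc_has_derivative[OF Suc.prems]])
      (intro Suc.IH C_k_Suc_derivative Suc.prems)
qed

lemma C_k_const: "C_k k (\<lambda>x. c)"
proof (induction k arbitrary: c)
  case (Suc k)
  then show ?case by (intro C_k_SucI[where f'="\<lambda>x v. 0"]) auto
qed auto

lemma C_k_add: "C_k k f \<Longrightarrow> C_k k g \<Longrightarrow> C_k k (\<lambda>x. f x + g x)"
proof (induction k arbitrary: f g)
  case 0
  then show ?case by (auto intro!: continuous_intros)
next
  case (Suc k)
  show ?case
    by (rule C_k_SucI[OF has_derivative_add[OF Suc.prems[THEN C_k_Suc_has_derivative]]])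
      (intro Suc.IH C_k_Suc_derivative Suc.prems)
qed

lemma C_k_mult: "C_k k f \<Longrightarrow> C_k k g \<Longrightarrow> C_k k (\<lambda>x. f x * g x)"
proof (induction k arbitrary: f g)
  case 0
  then show ?case by (auto intro!: continuous_intros)
next
  case (Suc k)
  show ?case
    by (rule C_k_SucI[OF has_derivative_mult[OF Suc.prems[THEN C_k_Suc_has_derivative]]])
      (intro C_k_add Suc.IH C_k_Suc_derivative Suc.prems Suc.prems[THEN C_k_SucD])
qed

section \<open>A smooth cut-off from below\<close>

text \<open>The family of all \<open>j\<close> is needed because the derivative of the flat function \<open>exp (- 1 / s)\<close>, extended
  by \<open>0\<close>, is a combination of members with larger \<open>j\<close>; smoothness follows for all of them at once.\<close>

definition flat_exp :: "nat \<Rightarrow> real \<Rightarrow> real" where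
  "flat_exp j s = (if 0 < s then exp (- 1 / s) / s ^ j else 0)"

lemma flat_exp_nonneg: "0 \<le> flat_exp j s"
  by (simp add: flat_exp_def)

text \<open>The quadratic bound makes every derivative vanish at the origin. It comes from keeping the single
  term of order \<open>j + 2\<close> in the power series of \<open>exp (1 / s)\<close>.\<close>

lemma flat_exp_le: "flat_exp j s \<le> fact (j + 2) * s\<^sup>2"
proof (cases "0 < s")
  case True
  have "(1 / s) ^ (j + 2) / fact (j + 2) \<le> exp (1 / s)"
  proof -
    have "(\<lambda>n. (1 / s) ^ n /\<^sub>R fact n) sums exp (1 / s)" by (rule exp_converges)
    from sum_le_suminf[OF sums_summable[OF this], of "{j + 2}"] sums_unique[OF this] True
    show ?thesis by (simp add: field_simps)
  qed
  moreover have "inverse E \<le> A * p" if "(1 / p) / A \<le> E" "0 < p" "0 < A" for A p E :: real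
  proof -
    have "0 < E" using that by (intro less_le_trans[OF _ that(1)]) simp
    with that show ?thesis by (simp add: field_simps)
  qed
  ultimately have "inverse (exp (1 / s)) \<le> fact (j + 2) * s ^ (j + 2)"
    using True by (simp only: power_one_over zero_less_power fact_gt_zero)
  then have "exp (- 1 / s) \<le> fact (j + 2) * s ^ (j + 2)"
    by (simp add: exp_minus)
  then show ?thesis using True
    by (simp add: flat_exp_def divide_simps power_add power2_eq_square ac_simps)
qed (simp add: flat_exp_def)

lemma flat_exp_has_derivative:
  "(flat_exp j has_real_derivative (flat_exp (j + 2) s - real j * flat_exp (j + 1) s)) (at s)"
proof -
  consider "0 < s" | "s < 0" | "s = 0" by linarith
  then show ?thesis
  proof cases
    case 1
    have e: "real j * s ^ (j - Suc 0) = real j * s ^ j / s"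
      using 1 by (cases j) auto
    have "((\<lambda>s. exp (- 1 / s) / s ^ j) has_real_derivative
        (exp (- 1 / s) * (1 / s\<^sup>2) * s ^ j - exp (- 1 / s) * (real j * s ^ (j - Suc 0)))
          / (s ^ j * s ^ j)) (at s)"
      using 1 by (auto intro!: derivative_eq_intros simp: power2_eq_square)
    then have "((\<lambda>s. exp (- 1 / s) / s ^ j) has_real_derivative
        (flat_exp (j + 2) s - real j * flat_exp (j + 1) s)) (at s)"
      unfolding e
    proof (rule DERIV_cong)
      have "(E * (1 / s\<^sup>2) * p - E * (real j * p / s)) / (p * p)
          = E / (p * s\<^sup>2) - real j * (E / (p * s))" if "p \<noteq> 0" for E p :: real
        using that 1 by (simp add: field_simps power2_eq_square)
      from this[of "s ^ j" "exp (- 1 / s)"] 1 show "(exp (- 1 / s) * (1 / s\<^sup>2) * s ^ j - exp (- 1 / s) * (real j * s ^ j / s))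
          / (s ^ j * s ^ j) = flat_exp (j + 2) s - real j * flat_exp (j + 1) s"
        by (simp add: flat_exp_def power_add power2_eq_square ac_simps)
    qed
    then show ?thesis
      by (rule DERIV_cong_ev[THEN iffD1, rotated -1])
        (use 1 in \<open>auto simp: flat_exp_def eventually_nhds intro!: exI[of _ "{0<..}"]\<close>)
  next
    case 2
    have "((\<lambda>s. 0) has_real_derivative
        (flat_exp (j + 2) s - real j * flat_exp (j + 1) s)) (at s)"
      using 2 by (simp add: flat_exp_def)
    then show ?thesis
      by (rule DERIV_cong_ev[THEN iffD1, rotated -1])
        (use 2 in \<open>auto simp: flat_exp_def eventually_nhds intro!: exI[of _ "{..<0}"]\<close>)
  next
    case 3
    have "((\<lambda>h. flat_exp j h / h) \<longlongrightarrow> 0) (at 0)"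
    proof (rule Lim_null_comparison)
      show "\<forall>\<^sub>F h in at 0. norm (flat_exp j h / h) \<le> fact (j + 2) * \<bar>h\<bar>"
      proof (rule always_eventually, rule allI)
        fix h :: real
        show "norm (flat_exp j h / h) \<le> fact (j + 2) * \<bar>h\<bar>"
          using flat_exp_le[of j h] flat_exp_nonneg[of j h]
          by (cases "h = 0") (auto simp: divide_simps power2_eq_square abs_if mult.assoc)
      qed
      show "((\<lambda>h. fact (j + 2) * \<bar>h\<bar>) \<longlongrightarrow> 0) (at (0::real))"
        by (auto intro!: tendsto_eq_intros)
    qed
    then show ?thesis unfolding 3 DERIV_def by (simp add: flat_exp_def)
  qed
qed

lemma C_k_flat_exp: "C_k k f \<Longrightarrow> C_k k (\<lambda>x. flat_exp j (f x))"
proof (induction k arbitrary: f j)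
  case 0
  have "continuous_on UNIV (flat_exp j)"
    using DERIV_continuous[OF flat_exp_has_derivative]
    by (intro continuous_at_imp_continuous_on) auto
  with 0 show ?case using continuous_on_compose2[of UNIV "flat_exp j" UNIV f] by simp
next
  case (Suc k)
  have f: "C_k k f" by (rule C_k_SucD[OF Suc.prems])
  have d: "((\<lambda>x. flat_exp j (f x)) has_derivative
      (\<lambda>v. frechet_derivative f (at x) v *
        (flat_exp (j + 2) (f x) + (- real j) * flat_exp (j + 1) (f x)))) (at x)" for x
    using has_derivative_compose[OF C_k_Suc_has_derivative[OF Suc.prems]
        flat_exp_has_derivative[of j "f x", unfolded has_field_derivative_def]]
    by (simp add: mult.commute)
  show ?case
    by (rule C_k_SucI[OF d])
      (intro C_k_mult C_k_add C_k_const Suc.IH f C_k_Suc_derivative[OF Suc.prems])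
qed

text \<open>This is \<open>s * exp (- h / s)\<close> for positive \<open>s\<close> and \<open>0\<close> otherwise: a smooth substitute for the positive
  part. Like the positive part, it is nondecreasing and a contraction, so it does not increase
  the energy. Unlike the positive part, it maps test functions to test functions.\<close>

definition soft_cut :: "real \<Rightarrow> real \<Rightarrow> real" where
  "soft_cut h s = s * flat_exp 0 (s / h)"

context
  fixes h :: real
  assumes h: "0 < h"
begin

lemma soft_cut_pos: "0 < s \<Longrightarrow> soft_cut h s = s * exp (- h / s)"
  using h by (simp add: soft_cut_def flat_exp_def)

lemma soft_cut_nonpos: "s \<le> 0 \<Longrightarrow> soft_cut h s = 0"
  using h by (simp add: soft_cut_def flat_exp_def divide_simps)

lemma soft_cut_nonneg: "0 \<le> soft_cut h s"
  by (cases "0 < s") (simp_all add: soft_cut_pos soft_cut_nonpos)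

lemma soft_cut_increment:
  assumes "s \<le> t"
  shows "soft_cut h s \<le> soft_cut h t" "soft_cut h t - soft_cut h s \<le> t - s"
proof -
  have pos: "soft_cut h a \<le> soft_cut h b \<and> soft_cut h b - soft_cut h a \<le> b - a"
    if ab: "0 < a" "a \<le> b" for a b
  proof -
    have d: "((\<lambda>s. s * exp (- h / s)) has_real_derivative ((1 + h / x) * exp (- h / x))) (at x)"
      if "0 < x" for x
      using that by (auto intro!: derivative_eq_intros simp: field_simps power2_eq_square)
    have "(\<lambda>s. s * exp (- h / s)) a \<le> (\<lambda>s. s * exp (- h / s)) b"
    proof (rule DERIV_nonneg_imp_nondecreasing[OF ab(2)])
      fix x assume x: "a \<le> x" "x \<le> b"
      then have "0 < x" using ab by simp
      moreover have "0 \<le> (1 + h / x) * exp (- h / x)" using \<open>0 < x\<close> h by simp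
      ultimately show "\<exists>y. ((\<lambda>s. s * exp (- h / s)) has_real_derivative y) (at x) \<and> 0 \<le> y"
        using d by blast
    qed
    moreover have "(\<lambda>s. s - s * exp (- h / s)) a \<le> (\<lambda>s. s - s * exp (- h / s)) b"
    proof (rule DERIV_nonneg_imp_nondecreasing[OF ab(2)])
      fix x assume x: "a \<le> x" "x \<le> b"
      then have "0 < x" using ab by simp
      have "1 + h / x \<le> exp (h / x)" by (rule exp_ge_add_one_self)
      then have "0 \<le> 1 - (1 + h / x) * exp (- h / x)" by (simp add: exp_minus field_simps)
      moreover have "((\<lambda>s. s - s * exp (- h / s)) has_real_derivative
          (1 - (1 + h / x) * exp (- h / x))) (at x)"
        by (intro derivative_intros d \<open>0 < x\<close>)
      ultimately show "\<exists>y. ((\<lambda>s. s - s * exp (- h / s)) has_real_derivative y) (at x) \<and> 0 \<le> y"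
        by blast
    qed
    ultimately show ?thesis using ab by (simp add: soft_cut_pos)
  qed
  have le: "soft_cut h b \<le> b" if "0 < b" for b
    using that h by (simp add: soft_cut_pos)
  show "soft_cut h s \<le> soft_cut h t"
    using pos[of s t] assms soft_cut_nonneg[of t] by (cases "0 < s") (auto simp: soft_cut_nonpos)
  show "soft_cut h t - soft_cut h s \<le> t - s"
    using pos[of s t] assms le[of t]
    by (cases "0 < s"; cases "0 < t") (auto simp: soft_cut_nonpos)
qed

lemma soft_cut_contraction: "\<bar>soft_cut h s - soft_cut h t\<bar> \<le> \<bar>s - t\<bar>"
  using soft_cut_increment[of s t] soft_cut_increment[of t s] by linarith

text \<open>For a nondecreasing contraction the increment of the image lies between \<open>0\<close> and that of the argument.
  This is what bounds the energy of a truncation by its mixed energy with the function truncated.\<close>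

lemma soft_cut_energy: "(soft_cut h s - soft_cut h t)\<^sup>2 \<le> (s - t) * (soft_cut h s - soft_cut h t)"
proof (cases "s \<le> t")
  case True
  then have "(t - s - (soft_cut h t - soft_cut h s)) * (soft_cut h t - soft_cut h s) \<ge> 0"
    using soft_cut_increment[of s t] by (intro mult_nonneg_nonneg) auto
  then show ?thesis by (simp add: power2_eq_square algebra_simps)
next
  case False
  then have "(s - t - (soft_cut h s - soft_cut h t)) * (soft_cut h s - soft_cut h t) \<ge> 0"
    using soft_cut_increment[of t s] by (intro mult_nonneg_nonneg) auto
  then show ?thesis by (simp add: power2_eq_square algebra_simps)
qed

text \<open>The soft cut is comparable to the positive part only at heights above \<open>h\<close>. The next
  lemma uses this there, and for smaller arguments \<open>s\<close> it uses \<open>s \<le> h\<close>.\<close>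

lemma soft_cut_ge: "h \<le> s \<Longrightarrow> exp (- 1) * s \<le> soft_cut h s"
  using h by (simp add: soft_cut_pos field_simps)

lemma mult_soft_cut_le: "s * soft_cut h s \<le> exp 1 * (soft_cut h s)\<^sup>2 + h * soft_cut h s"
proof (cases "h \<le> s")
  case True
  have "s \<le> exp 1 * soft_cut h s"
    using soft_cut_ge[OF True] by (simp add: exp_minus field_simps)
  then have "s * soft_cut h s \<le> exp 1 * soft_cut h s * soft_cut h s"
    by (intro mult_right_mono soft_cut_nonneg)
  then show ?thesis
    using mult_nonneg_nonneg[OF less_imp_le[OF h] soft_cut_nonneg[of s]]
    by (simp add: power2_eq_square mult.assoc)
next
  case False
  then have "s * soft_cut h s \<le> h * soft_cut h s"
    by (intro mult_right_mono soft_cut_nonneg) auto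
  then show ?thesis by (simp add: add_increasing)
qed

text \<open>Positivity of the level \<open>k\<close> makes the truncation vanish wherever the function does.\<close>

lemma test_functions_soft_cut:
  assumes u: "u \<in> test_functions D" and k: "0 < k"
  shows "(\<lambda>x. soft_cut h (u x - k)) \<in> test_functions D"
proof -
  have u1: "C_k n u" for n using u by (simp add: test_functions_def)
  have "C_k n (\<lambda>x. soft_cut h (u x - k))" for n
  proof -
    have "C_k n (\<lambda>x. (u x + - k) * flat_exp 0 ((u x + - k) * (1 / h)))"
      by (intro C_k_mult C_k_add C_k_const C_k_flat_exp u1)
    then show ?thesis by (simp add: soft_cut_def)
  qed
  moreover have sub: "closure {x. soft_cut h (u x - k) \<noteq> 0} \<subseteq> closure {x. u x \<noteq> 0}"
    using k by (intro closure_mono) (auto simp: soft_cut_nonpos)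
  moreover have "compact (closure {x. soft_cut h (u x - k) \<noteq> 0})"
    using u compact_Int_closed[of "closure {x. u x \<noteq> 0}" "closure {x. soft_cut h (u x - k) \<noteq> 0}"] sub
    by (simp add: test_functions_def Int_absorb1)
  ultimately show ?thesis using u by (auto simp: test_functions_def)
qed

end

section \<open>Second differences of test functions\<close>

lemma bounded_if_compact_support:
  fixes f :: "'a::euclidean_space \<Rightarrow> real"
  assumes "continuous_on UNIV f" "compact S" "\<And>x. x \<notin> S \<Longrightarrow> f x = 0"
  obtains B where "0 \<le> B" "\<And>x. \<bar>f x\<bar> \<le> B"
proof -
  have "compact (f ` S)"
    using assms by (intro compact_continuous_image continuous_on_subset[OF assms(1)]) auto
  then obtain B where B: "\<forall>x\<in>S. \<bar>f x\<bar> \<le> B"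
    by (auto dest!: compact_imp_bounded simp: bounded_iff)
  show ?thesis
  proof (rule that[of "max B 0"])
    show "\<bar>f x\<bar> \<le> max B 0" for x using B assms(3)[of x] by (cases "x \<in> S") auto
  qed simp
qed

lemma frechet_derivative_eq_0_off_support:
  assumes "closed S" "\<And>x. x \<notin> S \<Longrightarrow> f x = 0" "x \<notin> S"
  shows "frechet_derivative f (at x) v = 0"
proof -
  have "((\<lambda>x. 0) has_derivative (\<lambda>v. 0)) (at x)" by simp
  then have "(f has_derivative (\<lambda>v. 0)) (at x)"
    by (rule has_derivative_transform_within_open[of _ _ _ _ "- S"]) (use assms in auto)
  from frechet_derivative_at[OF this, symmetric] show ?thesis by (simp add: fun_eq_iff)
qed

lemma linear_bound_by_basis:
  fixes T :: "'a::euclidean_space \<Rightarrow> real"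
  assumes T: "linear T" and B: "\<And>b. b \<in> Basis \<Longrightarrow> \<bar>T b\<bar> \<le> B b"
  shows "\<bar>T w\<bar> \<le> (\<Sum>b\<in>Basis. B b) * norm w"
proof -
  have "T w = T (\<Sum>b\<in>Basis. (w \<bullet> b) *\<^sub>R b)" by (simp add: euclidean_representation)
  also have "\<dots> = (\<Sum>b\<in>Basis. (w \<bullet> b) * T b)"
    using T by (simp add: linear_sum linear_scale)
  finally have "\<bar>T w\<bar> \<le> (\<Sum>b\<in>Basis. \<bar>w \<bullet> b\<bar> * \<bar>T b\<bar>)"
    by (simp add: abs_mult[symmetric] sum_abs)
  also have "\<dots> \<le> (\<Sum>b\<in>Basis. norm w * B b)"
    by (intro sum_mono mult_mono Basis_le_norm B) auto
  finally show ?thesis by (simp add: sum_distrib_left mult.commute)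
qed

lemma C1_compact_support_lipschitz:
  fixes f :: "'a::euclidean_space \<Rightarrow> real"
  assumes f: "C_k 1 f" and S: "compact S" "\<And>x. x \<notin> S \<Longrightarrow> f x = 0"
  obtains L where "0 \<le> L" "\<And>x y. \<bar>f x - f y\<bar> \<le> L * norm (x - y)"
proof -
  have f1: "C_k (Suc 0) f" using f by simp
  have "\<exists>B\<ge>0. \<forall>x. \<bar>frechet_derivative f (at x) b\<bar> \<le> B" for b
  proof -
    have "continuous_on UNIV (\<lambda>x. frechet_derivative f (at x) b)"
      using C_k_Suc_derivative[OF f1, of b] by simp
    moreover have "frechet_derivative f (at x) b = 0" if "x \<notin> S" for x
      using compact_imp_closed[OF S(1)] S(2) that by (rule frechet_derivative_eq_0_off_support)
    ultimately obtain B where "0 \<le> B" "\<And>x. \<bar>frechet_derivative f (at x) b\<bar> \<le> B"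
      using bounded_if_compact_support[OF _ S(1)] by blast
    then show ?thesis by blast
  qed
  then obtain B where B: "\<And>b. 0 \<le> B b" "\<And>b x. \<bar>frechet_derivative f (at x) b\<bar> \<le> B b"
    by metis
  show ?thesis
  proof (rule that[of "\<Sum>b\<in>(Basis::'a set). B b"])
    show "0 \<le> (\<Sum>b\<in>(Basis::'a set). B b)" by (intro sum_nonneg B)
    fix x y
    have "norm (f x - f y) \<le> (\<Sum>b\<in>(Basis::'a set). B b) * norm (x - y)"
    proof (rule differentiable_bound[where S=UNIV and f'="\<lambda>x. frechet_derivative f (at x)"])
      fix x
      have d: "(f has_derivative frechet_derivative f (at x)) (at x)"
        by (rule C_k_Suc_has_derivative[OF f1])
      then show "(f has_derivative frechet_derivative f (at x)) (at x within UNIV)" by simp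
      show "onorm (frechet_derivative f (at x)) \<le> (\<Sum>b\<in>(Basis::'a set). B b)"
        using linear_bound_by_basis[OF has_derivative_linear[OF d], of B] B
        by (intro onorm_le) auto
    qed auto
    then show "\<bar>f x - f y\<bar> \<le> (\<Sum>b\<in>(Basis::'a set). B b) * norm (x - y)" by simp
  qed
qed

text \<open>As a function of \<open>z\<close>, the second difference vanishes at \<open>0\<close> and its derivative is the difference of
  the derivatives of \<open>f\<close> at two points at distance \<open>2 * norm z\<close>. Since the partial derivatives are
  Lipschitz continuous, this derivative is of order \<open>norm z\<close>.\<close>

lemma C2_compact_support_second_difference:
  fixes f :: "'a::euclidean_space \<Rightarrow> real"
  assumes f: "C_k 2 f" and S: "compact S" "\<And>x. x \<notin> S \<Longrightarrow> f x = 0"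
  obtains M where "0 \<le> M" "\<And>x z. \<bar>f (x + z) + f (x - z) - 2 * f x\<bar> \<le> M * (norm z)\<^sup>2"
proof -
  let ?D = "\<lambda>x. frechet_derivative f (at x)"
  have f2: "C_k (Suc 1) f" using f by (simp add: numeral_2_eq_2)
  have "\<exists>L\<ge>0. \<forall>x y. \<bar>?D x b - ?D y b\<bar> \<le> L * norm (x - y)" for b
  proof -
    have "C_k 1 (\<lambda>x. ?D x b)" by (rule C_k_Suc_derivative[OF f2])
    moreover have "?D x b = 0" if "x \<notin> S" for x
      using compact_imp_closed[OF S(1)] S(2) that by (rule frechet_derivative_eq_0_off_support)
    ultimately obtain L where "0 \<le> L" "\<And>x y. \<bar>?D x b - ?D y b\<bar> \<le> L * norm (x - y)"
      using C1_compact_support_lipschitz[OF _ S(1)] by blast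
    then show ?thesis by blast
  qed
  then obtain L where L: "\<And>b. 0 \<le> L b" "\<And>b x y. \<bar>?D x b - ?D y b\<bar> \<le> L b * norm (x - y)"
    by metis
  define M where "M = 2 * (\<Sum>b\<in>(Basis::'a set). L b)"
  have M0: "0 \<le> M" unfolding M_def by (intro mult_nonneg_nonneg sum_nonneg L) auto
  have dd: "(f has_derivative ?D p) (at p)" for p
    by (rule C_k_Suc_has_derivative[OF f2])
  have D_diff: "\<bar>?D p w - ?D q w\<bar> \<le> (\<Sum>b\<in>Basis. L b * norm (p - q)) * norm w" for p q w
    using linear_bound_by_basis[of "\<lambda>w. ?D p w - ?D q w" "\<lambda>b. L b * norm (p - q)" w] L(2)
    by (simp add: linear_compose_sub has_derivative_linear[OF dd])
  show ?thesis
  proof (rule that[OF M0])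
    fix x z0
    define g where "g = (\<lambda>z. f (x + z) + f (x - z) - 2 * f x)"
    have "norm (g z0 - g 0) \<le> (M * norm z0) * norm (z0 - 0)"
    proof (rule differentiable_bound[where S="cball 0 (norm z0)" and
          f'="\<lambda>z w. ?D (x + z) w - ?D (x - z) w"])
      fix z :: 'a
      assume z: "z \<in> cball 0 (norm z0)"
      have "((\<lambda>z. f (x + z)) has_derivative (\<lambda>w. ?D (x + z) w)) (at z)"
        by (rule has_derivative_compose[OF _ dd, where f="\<lambda>z. x + z" and f'="\<lambda>w. w", simplified])
          (auto intro!: derivative_eq_intros)
      moreover have "((\<lambda>z. f (x - z)) has_derivative (\<lambda>w. ?D (x - z) (- w))) (at z)"
        by (rule has_derivative_compose[OF _ dd, where f="\<lambda>z. x - z" and f'="\<lambda>w. - w", simplified])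
          (auto intro!: derivative_eq_intros)
      moreover have "?D (x - z) (- w) = - ?D (x - z) w" for w
        using linear_neg[OF has_derivative_linear[OF dd]] .
      ultimately have "((\<lambda>z. f (x + z) + f (x - z)) has_derivative
          (\<lambda>w. ?D (x + z) w + - ?D (x - z) w)) (at z)"
        by (simp only: has_derivative_add)
      from has_derivative_diff[OF this has_derivative_const[of "2 * f x"]]
      have "(g has_derivative (\<lambda>w. ?D (x + z) w - ?D (x - z) w)) (at z)"
        by (simp only: g_def diff_zero add_uminus_conv_diff)
      then show "(g has_derivative (\<lambda>w. ?D (x + z) w - ?D (x - z) w)) (at z within cball 0 (norm z0))"
        by (rule has_derivative_at_withinI)
      show "onorm (\<lambda>w. ?D (x + z) w - ?D (x - z) w) \<le> M * norm z0"
      proof (rule onorm_le)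
        fix w
        have "(x + z) - (x - z) = 2 *\<^sub>R z" by (simp add: scaleR_2)
        then have "\<bar>?D (x + z) w - ?D (x - z) w\<bar> \<le> M * norm z * norm w"
          using D_diff[of "x + z" w "x - z"]
          by (simp add: M_def sum_distrib_right[symmetric] mult.assoc mult.left_commute)
        also have "\<dots> \<le> M * norm z0 * norm w"
          using z M0 by (intro mult_mono) auto
        finally show "norm (?D (x + z) w - ?D (x - z) w) \<le> M * norm z0 * norm w" by simp
      qed
    qed auto
    then show "\<bar>f (x + z0) + f (x - z0) - 2 * f x\<bar> \<le> M * (norm z0)\<^sup>2"
      by (simp add: g_def power2_eq_square mult.assoc)
  qed
qed

section \<open>The fractional Laplacian as a limit of truncated operators\<close>

lemma lborel_distr_reflect: "distr lborel borel (\<lambda>z. c - z) = (lborel :: 'a::euclidean_space measure)"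
  using lborel_affine[of "- 1" c] by (simp add: density_1)

lemma lborel_reflect:
  fixes f :: "'a::euclidean_space \<Rightarrow> real"
  assumes [measurable]: "f \<in> borel_measurable borel"
  shows "(\<integral>z. f (c - z) \<partial>lborel) = (\<integral>z. f z \<partial>lborel)"
  using integral_distr[of "\<lambda>z. c - z" lborel borel f] by (simp add: lborel_distr_reflect)

lemma lborel_translate:
  fixes f :: "'a::euclidean_space \<Rightarrow> real"
  assumes [measurable]: "f \<in> borel_measurable borel"
  shows "integrable lborel (\<lambda>z. f (c + z)) \<longleftrightarrow> integrable lborel f"
    and "(\<integral>z. f (c + z) \<partial>lborel) = (\<integral>z. f z \<partial>lborel)"
  using integrable_distr_eq[of "(+) c" lborel borel f] integral_distr[of "(+) c" lborel borel f]
  by (simp_all add: lborel_distr_plus)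

definition truncated_laplacian :: "real \<Rightarrow> real \<Rightarrow> ('a::euclidean_space \<Rightarrow> real) \<Rightarrow> 'a \<Rightarrow> real" where
  "truncated_laplacian \<alpha> \<epsilon> u x = (\<integral>y. (u y - u x) * truncated_kernel \<alpha> \<epsilon> (y - x) \<partial>lborel)"

definition frac_constant :: "'a::euclidean_space itself \<Rightarrow> real \<Rightarrow> real" where
  "frac_constant _ \<alpha> = 2 powr \<alpha> * Gamma ((real DIM('a) + \<alpha>) / 2)
     / (pi powr (real DIM('a) / 2) * \<bar>Gamma (- \<alpha> / 2)\<bar>)"

lemma frac_constant_pos:
  assumes "0 < \<alpha>" "\<alpha> < 2"
  shows "0 < frac_constant TYPE('a::euclidean_space) \<alpha>"
proof -
  have "- \<alpha> / 2 \<notin> \<int>\<^sub>\<le>\<^sub>0"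
  proof
    assume "- \<alpha> / 2 \<in> \<int>\<^sub>\<le>\<^sub>0"
    then obtain n where "- \<alpha> / 2 = of_int n" "n \<le> 0" by (auto elim!: nonpos_Ints_cases)
    then have "real_of_int (- 1) < real_of_int n" "real_of_int n < real_of_int 0"
      using assms by (simp_all add: field_simps)
    then show False by (simp only: of_int_less_iff)
  qed
  then have "Gamma (- \<alpha> / 2) \<noteq> 0" by (simp add: Gamma_eq_zero_iff)
  moreover have "0 < Gamma ((real DIM('a) + \<alpha>) / 2)" using assms by (intro Gamma_real_pos) simp
  ultimately show ?thesis by (simp add: frac_constant_def)
qed

lemma frac_laplacian_eq_Lim:
  "frac_laplacian \<alpha> f (x::'a::euclidean_space) =
     frac_constant TYPE('a) \<alpha> * Lim (at_right 0) (\<lambda>\<epsilon>. truncated_laplacian \<alpha> \<epsilon> f x)"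
proof -
  have "indicator (- ball x \<epsilon>) y *\<^sub>R ((f y - f x) / norm (y - x) powr (real DIM('a) + \<alpha>))
      = (f y - f x) * truncated_kernel \<alpha> \<epsilon> (y - x)" for \<epsilon> y
    by (auto simp: truncated_kernel_def riesz_kernel_def indicator_def dist_norm norm_minus_commute
        powr_minus_divide divide_simps powr_diff powr_minus powr_add)
  then show ?thesis
    by (simp add: frac_laplacian_def frac_constant_def truncated_laplacian_def
        set_lebesgue_integral_def)
qed

text \<open>Averaging the integral over \<open>z\<close> and \<open>- z\<close> cancels the first order term of \<open>u (x + z) - u x\<close>, whose
  product with the kernel is not absolutely integrable near the origin when \<open>\<alpha> \<ge> 1\<close>.\<close>

lemma truncated_laplacian_second_difference:
  fixes u :: "'a::euclidean_space \<Rightarrow> real"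
  assumes \<alpha>: "0 < \<alpha>" "\<alpha> < 2" and \<epsilon>: "0 < \<epsilon>"
    and [measurable]: "u \<in> borel_measurable borel" and B: "\<And>x. \<bar>u x\<bar> \<le> B"
  shows "truncated_laplacian \<alpha> \<epsilon> u x
    = (\<integral>z. (u (x + z) + u (x - z) - 2 * u x) * truncated_kernel \<alpha> \<epsilon> z \<partial>lborel) / 2"
proof -
  let ?f = "\<lambda>s z. (u (x + s *\<^sub>R z) - u x) * truncated_kernel \<alpha> \<epsilon> z"
  have int: "integrable lborel (?f s)" for s
  proof (rule Bochner_Integration.integrable_bound)
    show "integrable lborel (\<lambda>z::'a. 2 * B * truncated_kernel \<alpha> \<epsilon> z)"
      by (intro integrable_mult_right integrable_truncated_kernel \<alpha> \<epsilon>)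
    show "AE z in lborel. norm (?f s z) \<le> norm (2 * B * truncated_kernel \<alpha> \<epsilon> z)"
    proof (rule AE_I2)
      fix z
      have "\<bar>u (x + s *\<^sub>R z) - u x\<bar> \<le> \<bar>2 * B\<bar>"
        using B[of "x + s *\<^sub>R z"] B[of x] by linarith
      then show "norm (?f s z) \<le> norm (2 * B * truncated_kernel \<alpha> \<epsilon> z)"
        by (simp add: abs_mult mult_right_mono)
    qed
  qed measurable
  have "truncated_laplacian \<alpha> \<epsilon> u x = integral\<^sup>L lborel (?f 1)"
    unfolding truncated_laplacian_def
    using lborel_translate(2)[of "\<lambda>y. (u y - u x) * truncated_kernel \<alpha> \<epsilon> (y - x)" x] by simp
  moreover have "integral\<^sup>L lborel (?f (- 1)) = integral\<^sup>L lborel (?f 1)"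
    using lborel_reflect[of "?f 1" 0] by simp
  moreover have "(\<integral>z. ?f 1 z + ?f (- 1) z \<partial>lborel) = integral\<^sup>L lborel (?f 1) + integral\<^sup>L lborel (?f (- 1))"
    by (rule Bochner_Integration.integral_add[OF int int])
  moreover have "?f 1 z + ?f (- 1) z = (u (x + z) + u (x - z) - 2 * u x) * truncated_kernel \<alpha> \<epsilon> z" for z
    by (simp add: algebra_simps)
  ultimately show ?thesis by simp
qed

text \<open>The second difference is at most a multiple of \<open>min 1 ((norm z)\<^sup>2)\<close>, uniformly in the base point. Dominated
  convergence gives the limit, and the same bound is uniform in \<open>x\<close> and \<open>\<epsilon>\<close>, so that the limit may
  later be exchanged with an integration over \<open>x\<close>.\<close>

lemma truncated_laplacian_limit:
  fixes u :: "'a::euclidean_space \<Rightarrow> real"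
  assumes \<alpha>: "0 < \<alpha>" "\<alpha> < 2"
    and u: "C_k 2 u" and S: "compact S" "\<And>x. x \<notin> S \<Longrightarrow> u x = 0"
  obtains B l where
    "\<And>x \<epsilon>. 0 < \<epsilon> \<Longrightarrow> \<bar>truncated_laplacian \<alpha> \<epsilon> u x\<bar> \<le> B"
    "\<And>x. ((\<lambda>\<epsilon>. truncated_laplacian \<alpha> \<epsilon> u x) \<longlongrightarrow> l x) (at_right 0)"
proof -
  have cont: "continuous_on UNIV u"
    using u C_k_SucD[of 1 u] C_k_SucD[of 0 u] by (simp add: numeral_2_eq_2)
  then have [measurable]: "u \<in> borel_measurable borel" by (rule borel_measurable_continuous_onI)
  obtain A where A: "0 \<le> A" "\<And>x. \<bar>u x\<bar> \<le> A"
    using bounded_if_compact_support[OF cont S] by blast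
  obtain M where M: "0 \<le> M" "\<And>x z. \<bar>u (x + z) + u (x - z) - 2 * u x\<bar> \<le> M * (norm z)\<^sup>2"
    using C2_compact_support_second_difference[OF u S] by blast
  define c where "c = max M (4 * A)"
  let ?w = "\<lambda>z::'a. c * (min 1 ((norm z)\<^sup>2) * riesz_kernel \<alpha> z)"
  let ?s = "\<lambda>x z. u (x + z) + u (x - z) - 2 * u x"
  have w: "integrable lborel ?w" by (intro integrable_mult_right integrable_levy_measure \<alpha>)
  have c: "\<bar>?s x z\<bar> \<le> c * min 1 ((norm z)\<^sup>2)" for x z
  proof -
    have "\<bar>?s x z\<bar> \<le> 4 * A" using A(2)[of "x + z"] A(2)[of "x - z"] A(2)[of x] by linarith
    then have "\<bar>?s x z\<bar> \<le> c" by (simp add: c_def)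
    moreover have "\<bar>?s x z\<bar> \<le> c * (norm z)\<^sup>2"
      using M(2)[of x z] by (rule order.trans) (simp add: c_def mult_right_mono)
    ultimately show ?thesis by (simp add: min_def)
  qed
  have bound: "norm (?s x z * truncated_kernel \<alpha> \<epsilon> z) \<le> ?w z" for x z \<epsilon>
  proof -
    have "norm (?s x z * truncated_kernel \<alpha> \<epsilon> z) = \<bar>?s x z\<bar> * truncated_kernel \<alpha> \<epsilon> z"
      by (simp add: abs_mult)
    also have "\<dots> \<le> (c * min 1 ((norm z)\<^sup>2)) * riesz_kernel \<alpha> z"
      using A c[of x z] by (intro mult_mono c) (auto simp: truncated_kernel_def indicator_def c_def)
    finally show ?thesis by (simp add: mult.assoc)
  qed
  show ?thesis
  proof (rule that)
    fix x :: 'a and \<epsilon> :: real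
    assume \<epsilon>: "0 < \<epsilon>"
    have "\<bar>\<integral>z. ?s x z * truncated_kernel \<alpha> \<epsilon> z \<partial>lborel\<bar>
        \<le> (\<integral>z. norm (?s x z * truncated_kernel \<alpha> \<epsilon> z) \<partial>lborel)"
      using integral_norm_bound[of lborel "\<lambda>z. ?s x z * truncated_kernel \<alpha> \<epsilon> z"] by simp
    also have "\<dots> \<le> integral\<^sup>L lborel ?w"
      using order.trans[OF norm_ge_zero bound] by (intro integral_mono' w bound) simp
    finally have "\<bar>\<integral>z. ?s x z * truncated_kernel \<alpha> \<epsilon> z \<partial>lborel\<bar> \<le> integral\<^sup>L lborel ?w" .
    then show "\<bar>truncated_laplacian \<alpha> \<epsilon> u x\<bar> \<le> integral\<^sup>L lborel ?w / 2"
      by (simp add: truncated_laplacian_second_difference[OF \<alpha> \<epsilon> _ A(2)])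
  next
    fix x :: 'a
    show "((\<lambda>\<epsilon>. truncated_laplacian \<alpha> \<epsilon> u x) \<longlongrightarrow>
        (\<integral>z. ?s x z * riesz_kernel \<alpha> z \<partial>lborel) / 2) (at_right 0)"
    proof (rule tendsto_at_right_sequentially[of 0 1])
      fix e :: "nat \<Rightarrow> real"
      assume e: "\<And>n. 0 < e n" "e \<longlonglongrightarrow> 0"
      have "(\<lambda>n. \<integral>z. ?s x z * truncated_kernel \<alpha> (e n) z \<partial>lborel)
          \<longlonglongrightarrow> (\<integral>z. ?s x z * riesz_kernel \<alpha> z \<partial>lborel)"
      proof (rule integral_dominated_convergence[OF _ _ w])
        show "AE z in lborel. (\<lambda>n. ?s x z * truncated_kernel \<alpha> (e n) z) \<longlonglongrightarrow> ?s x z * riesz_kernel \<alpha> z"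
        proof (rule AE_I2, rule tendsto_eventually)
          fix z
          show "\<forall>\<^sub>F n in sequentially. ?s x z * truncated_kernel \<alpha> (e n) z = ?s x z * riesz_kernel \<alpha> z"
          proof (cases "z = 0")
            case True
            then show ?thesis by (simp add: truncated_kernel_def riesz_kernel_def)
          next
            case False
            then have "\<forall>\<^sub>F n in sequentially. e n < norm z" using order_tendstoD(2)[OF e(2)] by simp
            then show ?thesis by eventually_elim (simp add: truncated_kernel_def)
          qed
        qed
      qed (use bound in auto)
      then show "(\<lambda>n. truncated_laplacian \<alpha> (e n) u x) \<longlonglongrightarrow>
          (\<integral>z. ?s x z * riesz_kernel \<alpha> z \<partial>lborel) / 2"
        using e by (simp add: truncated_laplacian_second_difference[OF \<alpha> _ _ A(2)] tendsto_divide)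
    qed simp
  qed
qed

section \<open>The energy form\<close>

definition truncated_energy ::
  "real \<Rightarrow> real \<Rightarrow> ('a::euclidean_space \<Rightarrow> real) \<Rightarrow> ('a \<Rightarrow> real) \<Rightarrow> real" where
  "truncated_energy \<alpha> \<epsilon> u v =
     (\<integral>(x, y). (u x - u y) * (v x - v y) * truncated_kernel \<alpha> \<epsilon> (y - x) \<partial>(lborel \<Otimes>\<^sub>M lborel))"

lemma integrable_kernel_weighted:
  fixes v :: "'a::euclidean_space \<Rightarrow> real" and g :: "'a \<times> 'a \<Rightarrow> real"
  assumes \<alpha>: "0 < \<alpha>" "\<alpha> < 2" and \<epsilon>: "0 < \<epsilon>"
    and g [measurable]: "g \<in> borel_measurable (borel \<Otimes>\<^sub>M borel)" and B: "\<And>p. \<bar>g p\<bar> \<le> B"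
    and v: "integrable lborel v"
  shows "integrable (lborel \<Otimes>\<^sub>M lborel) (\<lambda>(x, y). v x * g (x, y) * truncated_kernel \<alpha> \<epsilon> (y - x))"
proof -
  have [measurable]: "v \<in> borel_measurable borel" using borel_measurable_integrable[OF v] by simp
  have K: "integrable lborel (\<lambda>y. truncated_kernel \<alpha> \<epsilon> (y - x))" for x :: 'a
    using lborel_translate(1)[of "truncated_kernel \<alpha> \<epsilon>" "- x"] integrable_truncated_kernel[OF \<alpha> \<epsilon>]
    by simp
  have Kint: "(\<integral>y. truncated_kernel \<alpha> \<epsilon> (y - x) \<partial>lborel) = integral\<^sup>L lborel (truncated_kernel \<alpha> \<epsilon> :: 'a \<Rightarrow> real)" for x :: 'a
    using lborel_translate(2)[of "truncated_kernel \<alpha> \<epsilon>" "- x"] by simp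
  have bd: "norm (v x * g (x, y) * truncated_kernel \<alpha> \<epsilon> (y - x))
      \<le> \<bar>v x\<bar> * B * truncated_kernel \<alpha> \<epsilon> (y - x)" for x y
    by (simp add: abs_mult mult_right_mono mult_left_mono B)
  have inner: "integrable lborel (\<lambda>y. v x * g (x, y) * truncated_kernel \<alpha> \<epsilon> (y - x))" for x
    by (rule Bochner_Integration.integrable_bound[OF integrable_mult_right[OF K, of "\<bar>v x\<bar> * B" x]])
      (use order.trans[OF bd abs_ge_self] in auto)
  show ?thesis
  proof (rule lborel_pair.Fubini_integrable)
    show "integrable lborel (\<lambda>x. \<integral>y. norm (case (x, y) of (x, y) \<Rightarrow>
        v x * g (x, y) * truncated_kernel \<alpha> \<epsilon> (y - x)) \<partial>lborel)"
    proof (rule Bochner_Integration.integrable_bound)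
      show "integrable lborel (\<lambda>x. v x * (B * integral\<^sup>L lborel (truncated_kernel \<alpha> \<epsilon> :: 'a \<Rightarrow> real)))"
        using v by (rule integrable_mult_left)
      show "AE x in lborel. norm (\<integral>y. norm (case (x, y) of (x, y) \<Rightarrow>
          v x * g (x, y) * truncated_kernel \<alpha> \<epsilon> (y - x)) \<partial>lborel)
          \<le> norm (v x * (B * integral\<^sup>L lborel (truncated_kernel \<alpha> \<epsilon> :: 'a \<Rightarrow> real)))"
      proof (rule AE_I2)
        fix x
        have "(\<integral>y. norm (v x * g (x, y) * truncated_kernel \<alpha> \<epsilon> (y - x)) \<partial>lborel)
            \<le> (\<integral>y. \<bar>v x\<bar> * B * truncated_kernel \<alpha> \<epsilon> (y - x) \<partial>lborel)"
          by (rule integral_mono[OF integrable_norm[OF inner] integrable_mult_right[OF K] bd])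
        also have "\<dots> = \<bar>v x\<bar> * B * integral\<^sup>L lborel (truncated_kernel \<alpha> \<epsilon> :: 'a \<Rightarrow> real)"
          by (simp add: Kint)
        also have "\<dots> \<le> norm (v x * (B * integral\<^sup>L lborel (truncated_kernel \<alpha> \<epsilon> :: 'a \<Rightarrow> real)))"
          by (simp add: abs_mult mult_left_mono mult_right_mono mult.assoc)
        finally show "norm (\<integral>y. norm (case (x, y) of (x, y) \<Rightarrow>
          v x * g (x, y) * truncated_kernel \<alpha> \<epsilon> (y - x)) \<partial>lborel)
          \<le> norm (v x * (B * integral\<^sup>L lborel (truncated_kernel \<alpha> \<epsilon> :: 'a \<Rightarrow> real)))"
          by simp
      qed
    qed measurable
    show "AE x in lborel. integrable lborel (\<lambda>y. case (x, y) of (x, y) \<Rightarrow>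
        v x * g (x, y) * truncated_kernel \<alpha> \<epsilon> (y - x))"
      using inner by simp
  qed measurable
qed

text \<open>Integration by parts for a symmetric kernel: the double integral of
  \<open>v x * (u x - u y) * truncated_kernel \<alpha> \<epsilon> (y - x)\<close> is unchanged when \<open>x\<close> and \<open>y\<close> are exchanged, and
  the sum of the two versions is the energy. The truncation of the kernel provides the absolute
  integrability for Fubini.\<close>

lemma truncated_energy_parts:
  fixes u v :: "'a::euclidean_space \<Rightarrow> real"
  assumes \<alpha>: "0 < \<alpha>" "\<alpha> < 2" and \<epsilon>: "0 < \<epsilon>"
    and u [measurable]: "u \<in> borel_measurable borel" and B: "\<And>x. \<bar>u x\<bar> \<le> B"
    and v: "integrable lborel v"
  shows integrable_truncated_energy: "integrable (lborel \<Otimes>\<^sub>M lborel)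
      (\<lambda>(x, y). (u x - u y) * (v x - v y) * truncated_kernel \<alpha> \<epsilon> (y - x))"
    and truncated_energy_eq: "truncated_energy \<alpha> \<epsilon> u v
      = 2 * (\<integral>x. - truncated_laplacian \<alpha> \<epsilon> u x * v x \<partial>lborel)"
proof -
  define \<Phi> where "\<Phi> = (\<lambda>(x, y). v x * (u x - u y) * truncated_kernel \<alpha> \<epsilon> (y - x))"
  have "\<bar>u (fst p) - u (snd p)\<bar> \<le> 2 * B" for p
    using B[of "fst p"] B[of "snd p"] by simp
  from integrable_kernel_weighted[where g="\<lambda>p. u (fst p) - u (snd p)", OF \<alpha> \<epsilon> _ this v]
  have \<Phi>: "integrable (lborel \<Otimes>\<^sub>M lborel) \<Phi>"
    by (simp add: \<Phi>_def)
  have \<Phi>': "integrable (lborel \<Otimes>\<^sub>M lborel) (\<lambda>(x, y). \<Phi> (y, x))"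
    using \<Phi> by (rule lborel_pair.integrable_product_swap)
  have "truncated_kernel \<alpha> \<epsilon> (x - y) = truncated_kernel \<alpha> \<epsilon> (y - x)" for x y :: 'a
    using truncated_kernel_minus[of \<alpha> \<epsilon> "y - x"] by simp
  then have eq: "(\<lambda>(x, y). (u x - u y) * (v x - v y) * truncated_kernel \<alpha> \<epsilon> (y - x))
      = (\<lambda>p. \<Phi> p + (case p of (x, y) \<Rightarrow> \<Phi> (y, x)))"
    by (auto simp: \<Phi>_def fun_eq_iff algebra_simps)
  show "integrable (lborel \<Otimes>\<^sub>M lborel)
      (\<lambda>(x, y). (u x - u y) * (v x - v y) * truncated_kernel \<alpha> \<epsilon> (y - x))"
    unfolding eq using \<Phi> \<Phi>' by (rule Bochner_Integration.integrable_add)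
  have "truncated_energy \<alpha> \<epsilon> u v = integral\<^sup>L (lborel \<Otimes>\<^sub>M lborel) \<Phi>
      + integral\<^sup>L (lborel \<Otimes>\<^sub>M lborel) (\<lambda>(x, y). \<Phi> (y, x))"
    unfolding truncated_energy_def eq using \<Phi> \<Phi>' by (rule Bochner_Integration.integral_add)
  also have "integral\<^sup>L (lborel \<Otimes>\<^sub>M lborel) (\<lambda>(x, y). \<Phi> (y, x)) = integral\<^sup>L (lborel \<Otimes>\<^sub>M lborel) \<Phi>"
    using borel_measurable_integrable[OF \<Phi>] by (rule lborel_pair.integral_product_swap)
  also have "integral\<^sup>L (lborel \<Otimes>\<^sub>M lborel) \<Phi> = (\<integral>x. \<integral>y. \<Phi> (x, y) \<partial>lborel \<partial>lborel)"
    using lborel_pair.integral_fst'[OF \<Phi>] by simp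
  also have "\<dots> = (\<integral>x. - truncated_laplacian \<alpha> \<epsilon> u x * v x \<partial>lborel)"
  proof (rule Bochner_Integration.integral_cong[OF refl])
    fix x
    have "(\<integral>y. \<Phi> (x, y) \<partial>lborel)
        = (\<integral>y. (- v x) * ((u y - u x) * truncated_kernel \<alpha> \<epsilon> (y - x)) \<partial>lborel)"
      by (intro Bochner_Integration.integral_cong) (auto simp: \<Phi>_def algebra_simps)
    then show "(\<integral>y. \<Phi> (x, y) \<partial>lborel) = - truncated_laplacian \<alpha> \<epsilon> u x * v x"
      by (simp add: truncated_laplacian_def)
  qed
  finally show "truncated_energy \<alpha> \<epsilon> u v
      = 2 * (\<integral>x. - truncated_laplacian \<alpha> \<epsilon> u x * v x \<partial>lborel)" by simp
qed

section \<open>The Dirichlet form on test functions\<close>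

lemma test_functions_facts:
  assumes u: "u \<in> test_functions D"
  shows test_functions_C_k: "C_k n u"
    and test_functions_off_support: "x \<notin> closure {x. u x \<noteq> 0} \<Longrightarrow> u x = 0"
    and test_functions_eq_0: "x \<notin> D \<Longrightarrow> u x = 0"
    and test_functions_compact: "compact (closure {x. u x \<noteq> 0})"
    and test_functions_continuous: "continuous_on UNIV u"
    and test_functions_measurable: "u \<in> borel_measurable borel"
proof -
  have c: "C_k n u" for n using u by (simp add: test_functions_def)
  show "C_k n u" by (rule c)
  show z: "x \<notin> closure {x. u x \<noteq> 0} \<Longrightarrow> u x = 0" for x
    using closure_subset[of "{x. u x \<noteq> 0}"] by auto
  show "x \<notin> D \<Longrightarrow> u x = 0"
    using u z[of x] by (auto simp: test_functions_def)
  show "compact (closure {x. u x \<noteq> 0})"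
    using u by (simp add: test_functions_def)
  show "continuous_on UNIV u" using c[of 0] by simp
  then show "u \<in> borel_measurable borel" by (rule borel_measurable_continuous_onI)
qed

lemma test_functions_bounded:
  assumes u: "u \<in> test_functions D"
  obtains B where "0 \<le> B" "\<And>x. \<bar>u x\<bar> \<le> B"
proof (rule bounded_if_compact_support)
  show "continuous_on UNIV u" by (rule test_functions_continuous[OF u])
  show "compact (closure {x. u x \<noteq> 0})" by (rule test_functions_compact[OF u])
  show "x \<notin> closure {x. u x \<noteq> 0} \<Longrightarrow> u x = 0" for x by (rule test_functions_off_support[OF u])
qed (rule that)

lemma test_functions_integrable:
  fixes u :: "'a::euclidean_space \<Rightarrow> real"
  assumes u: "u \<in> test_functions D"
  shows "integrable lborel u" and "integrable lborel (\<lambda>x. (u x)\<^sup>2)"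
proof -
  note [measurable] = test_functions_measurable[OF u]
  obtain B where B: "0 \<le> B" "\<And>x. \<bar>u x\<bar> \<le> B" using test_functions_bounded[OF u] by blast
  define S where "S = closure {x. u x \<noteq> 0}"
  have S: "integrable lborel (\<lambda>x. c * indicator S x :: real)" for c
    using emeasure_compact_finite[OF test_functions_compact[OF u]]
    by (intro integrable_mult_right integrable_real_indicator) (simp_all add: S_def)
  have z: "u x = 0" if "x \<notin> S" for x
    using that unfolding S_def by (rule test_functions_off_support[OF u])
  show "integrable lborel u"
  proof (rule Bochner_Integration.integrable_bound[OF S[of B]])
    have "\<bar>u x\<bar> \<le> \<bar>B * indicator S x\<bar>" for x
      using B(1) B(2)[of x] z[of x] by (cases "x \<in> S") simp_all
    then show "AE x in lborel. norm (u x) \<le> norm (B * indicator S x)" by simp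
  qed measurable
  show "integrable lborel (\<lambda>x. (u x)\<^sup>2)"
  proof (rule Bochner_Integration.integrable_bound[OF S[of "B\<^sup>2"]])
    have "(u x)\<^sup>2 \<le> B\<^sup>2 * indicator S x" for x
      using power_mono[OF B(2)[of x], of 2] z[of x] by (cases "x \<in> S") simp_all
    then show "AE x in lborel. norm ((u x)\<^sup>2) \<le> norm (B\<^sup>2 * indicator S x)" by simp
  qed measurable
qed

lemma test_functions_diff:
  assumes u: "u \<in> test_functions D" and v: "v \<in> test_functions D"
  shows "(\<lambda>x. u x - v x) \<in> test_functions D"
proof -
  have "C_k n (\<lambda>x. u x + (- 1) * v x)" for n
    by (intro C_k_add C_k_mult C_k_const test_functions_C_k[OF u] test_functions_C_k[OF v])
  moreover have sub: "closure {x. u x - v x \<noteq> 0} \<subseteq> closure {x. u x \<noteq> 0} \<union> closure {x. v x \<noteq> 0}"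
    unfolding closure_Un[symmetric] by (rule closure_mono) auto
  moreover have "compact (closure {x. u x \<noteq> 0} \<union> closure {x. v x \<noteq> 0})"
    by (intro compact_Un test_functions_compact[OF u] test_functions_compact[OF v])
  from compact_Int_closed[OF this closed_closure[of "{x. u x - v x \<noteq> 0}"]]
  have "compact (closure {x. u x - v x \<noteq> 0})"
    unfolding Int_absorb1[OF sub] .
  ultimately show ?thesis using u v by (auto simp: test_functions_def)
qed

lemma truncated_laplacian_measurable [measurable]:
  assumes [measurable]: "u \<in> borel_measurable borel"
  shows "truncated_laplacian \<alpha> \<epsilon> u \<in> borel_measurable borel"
  unfolding truncated_laplacian_def by measurable

definition dirichlet_form ::
  "real \<Rightarrow> 'a::euclidean_space set \<Rightarrow> ('a \<Rightarrow> real) \<Rightarrow> ('a \<Rightarrow> real) \<Rightarrow> real" where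
  "dirichlet_form \<alpha> D u v = L2_inner D (\<lambda>x. - frac_laplacian \<alpha> u x * indicator D x) v"

text \<open>All inequalities for the Dirichlet form are proved for the truncated energies, where they can be
  read off pointwise under the double integral, and carried over by this limit.\<close>

lemma dirichlet_form_limit:
  fixes u v :: "'a::euclidean_space \<Rightarrow> real"
  assumes \<alpha>: "0 < \<alpha>" "\<alpha> < 2"
    and u: "u \<in> test_functions D" and v: "v \<in> test_functions D"
  shows "((\<lambda>\<epsilon>. frac_constant TYPE('a) \<alpha> / 2 * truncated_energy \<alpha> \<epsilon> u v)
    \<longlongrightarrow> dirichlet_form \<alpha> D u v) (at_right 0)"
proof -
  note [measurable] = test_functions_measurable[OF u] test_functions_measurable[OF v]
  let ?C = "frac_constant TYPE('a) \<alpha>"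
  obtain A where A: "\<And>x. \<bar>u x\<bar> \<le> A" using test_functions_bounded[OF u] by blast
  obtain B l where
    B: "\<And>x \<epsilon>. 0 < \<epsilon> \<Longrightarrow> \<bar>truncated_laplacian \<alpha> \<epsilon> u x\<bar> \<le> B" and
    l: "\<And>x. ((\<lambda>\<epsilon>. truncated_laplacian \<alpha> \<epsilon> u x) \<longlongrightarrow> l x) (at_right 0)"
    using truncated_laplacian_limit[OF \<alpha> test_functions_C_k[OF u] test_functions_compact[OF u]
        test_functions_off_support[OF u]] by blast
  have "frac_laplacian \<alpha> u x = ?C * l x" for x
    using tendsto_Lim[OF _ l[of x]] by (simp add: frac_laplacian_eq_Lim)
  then have "indicator D x *\<^sub>R (- frac_laplacian \<alpha> u x * indicator D x * v x) = ?C * (- l x * v x)" for x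
    using test_functions_eq_0[OF v, of x] by (cases "x \<in> D") simp_all
  then have form: "dirichlet_form \<alpha> D u v = ?C * (\<integral>x. - l x * v x \<partial>lborel)"
    unfolding dirichlet_form_def L2_inner_def set_lebesgue_integral_def
    by (simp only: integral_mult_right_zero)
  show ?thesis
  proof (rule tendsto_at_right_sequentially[of 0 1])
    fix e :: "nat \<Rightarrow> real"
    assume e: "\<And>n. 0 < e n" "e \<longlonglongrightarrow> 0"
    have le: "(\<lambda>n. truncated_laplacian \<alpha> (e n) u x) \<longlonglongrightarrow> l x" for x
      by (rule filterlim_compose[OF l])
        (use e(2) in \<open>simp add: filterlim_at e(1) e(1)[THEN less_imp_neq, THEN not_sym]\<close>)
    have [measurable]: "l \<in> borel_measurable borel"
      using le by (rule borel_measurable_LIMSEQ_real) measurable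
    have "(\<lambda>n. \<integral>x. - truncated_laplacian \<alpha> (e n) u x * v x \<partial>lborel)
        \<longlonglongrightarrow> (\<integral>x. - l x * v x \<partial>lborel)"
    proof (rule integral_dominated_convergence[where w="\<lambda>x. B * \<bar>v x\<bar>"])
      show "integrable lborel (\<lambda>x. B * \<bar>v x\<bar>)"
        by (intro integrable_mult_right integrable_abs test_functions_integrable[OF v])
      show "AE x in lborel. (\<lambda>n. - truncated_laplacian \<alpha> (e n) u x * v x) \<longlonglongrightarrow> - l x * v x"
        by (intro AE_I2 tendsto_intros le)
      show "AE x in lborel. norm (- truncated_laplacian \<alpha> (e n) u x * v x) \<le> B * \<bar>v x\<bar>" for n
        using B[OF e(1)[of n]] by (intro AE_I2) (simp add: abs_mult mult_right_mono)
    qed auto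
    then have "(\<lambda>n. ?C * (\<integral>x. - truncated_laplacian \<alpha> (e n) u x * v x \<partial>lborel))
        \<longlonglongrightarrow> ?C * (\<integral>x. - l x * v x \<partial>lborel)" by (rule tendsto_mult_left)
    moreover have "?C / 2 * truncated_energy \<alpha> (e n) u v
        = ?C * (\<integral>x. - truncated_laplacian \<alpha> (e n) u x * v x \<partial>lborel)" for n
      using truncated_energy_eq[OF \<alpha> e(1) test_functions_measurable[OF u] A
          test_functions_integrable(1)[OF v]] by simp
    ultimately show "(\<lambda>n. ?C / 2 * truncated_energy \<alpha> (e n) u v) \<longlonglongrightarrow> dirichlet_form \<alpha> D u v"
      by (simp only: form)
  qed simp
qed

section \<open>The Faber--Krahn inequality\<close>

text \<open>A nonlocal form penalises the jumps out of the support: if \<open>v\<close> vanishes outside \<open>S\<close>, then already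
  the pairs \<open>(x, y)\<close> with \<open>y \<notin> S\<close> contribute \<open>(v x)\<^sup>2\<close> times the mass of the kernel around \<open>x\<close>
  outside \<open>S\<close>. If \<open>S\<close> has measure at most \<open>a\<close>, this mass is at least of the order of \<open>a powr (- \<alpha> / d)\<close>,
  the mass outside a ball of comparable volume.\<close>

definition faber_krahn_constant :: "'a::euclidean_space itself \<Rightarrow> real \<Rightarrow> real" where
  "faber_krahn_constant _ \<alpha> =
     (3 / unit_ball_vol (real DIM('a))) powr - ((real DIM('a) + \<alpha>) / real DIM('a))"

text \<open>The radius \<open>R\<close> is chosen so that the ball has volume \<open>3 * a\<close>. Removing \<open>S\<close> and the truncated ball, each
  of measure at most \<open>a\<close>, leaves at least \<open>a\<close>, and the kernel is at least \<open>R powr - (d + \<alpha>)\<close> there.\<close>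

lemma kernel_mass_outside:
  fixes S :: "'a::euclidean_space set"
  assumes \<alpha>: "0 < \<alpha>" "\<alpha> < 2" and \<epsilon>: "0 < \<epsilon>"
    and S [measurable]: "S \<in> sets lborel" and fin: "emeasure lborel S < \<infinity>"
    and a: "measure lborel S \<le> a" "0 < a" and small: "unit_ball_vol DIM('a) * \<epsilon> ^ DIM('a) \<le> a"
  shows "faber_krahn_constant TYPE('a) \<alpha> * a powr - (\<alpha> / DIM('a))
    \<le> (\<integral>y. indicator (- S) y * truncated_kernel \<alpha> \<epsilon> (y - x) \<partial>lborel)"
proof -
  let ?d = "real DIM('a)" and ?\<omega> = "unit_ball_vol (real DIM('a))"
  define R where "R = (3 * a / ?\<omega>) powr (1 / ?d)"
  have \<omega>: "0 < ?\<omega>" by simp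
  then have \<omega>0: "?\<omega> \<noteq> 0" by linarith
  have R: "0 < R" using a \<omega> by (simp add: R_def \<omega>0)
  have "R ^ DIM('a) = R powr ?d" using R by (simp add: powr_realpow)
  also have "\<dots> = 3 * a / ?\<omega>" using a \<omega> by (simp add: R_def powr_powr \<omega>0)
  finally have vR: "?\<omega> * R ^ DIM('a) = 3 * a" using \<omega>0 by simp
  define T where "T = ball x R - ball x \<epsilon> - S"
  have [measurable]: "T \<in> sets borel" using S by (auto simp: T_def)
  have fT: "emeasure lborel T < \<infinity>"
    using emeasure_mono[of T "ball x R" lborel] emeasure_lborel_ball_finite[of x R]
    by (auto simp: T_def intro: le_less_trans)
  have T: "a \<le> measure lborel T"
  proof -
    have fS: "S \<in> fmeasurable lborel" using S fin by (intro fmeasurableI) auto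
    have "measure lborel (ball x R) \<le> measure lborel (T \<union> (ball x \<epsilon> \<union> S))"
    proof (rule measure_mono_fmeasurable)
      have "T \<in> fmeasurable lborel" using fT by (intro fmeasurableI) auto
      moreover have "ball x \<epsilon> \<in> fmeasurable lborel"
        by (intro fmeasurableI emeasure_lborel_ball_finite) simp
      ultimately show "T \<union> (ball x \<epsilon> \<union> S) \<in> fmeasurable lborel"
        using fS by (intro fmeasurable.Un)
    qed (auto simp: T_def)
    also have "\<dots> \<le> measure lborel T + measure lborel (ball x \<epsilon> \<union> S)"
      by (rule measure_Un_le) (use S in auto)
    also have "measure lborel (ball x \<epsilon> \<union> S) \<le> measure lborel (ball x \<epsilon>) + measure lborel S"
      by (rule measure_Un_le) (use S in auto)
    finally show ?thesis
      using a small vR R \<epsilon> by (simp add: content_ball)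
  qed
  have K: "integrable lborel (\<lambda>y. truncated_kernel \<alpha> \<epsilon> (y - x))"
    using lborel_translate(1)[of "truncated_kernel \<alpha> \<epsilon>" "- x"] integrable_truncated_kernel[OF \<alpha> \<epsilon>]
    by simp
  have e1: "- ((?d + \<alpha>) / ?d) = - (\<alpha> / ?d) - 1" by (simp add: field_simps)
  have "faber_krahn_constant TYPE('a) \<alpha> * a powr - (\<alpha> / ?d)
      = (3 / ?\<omega>) powr - ((?d + \<alpha>) / ?d) * a powr - ((?d + \<alpha>) / ?d) * a"
    using a by (simp add: faber_krahn_constant_def e1 powr_diff)
  also have "\<dots> = (3 * a / ?\<omega>) powr - ((?d + \<alpha>) / ?d) * a"
    using a \<omega> powr_mult[of "3 / ?\<omega>" a "- ((?d + \<alpha>) / ?d)"] by simp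
  also have "\<dots> = R powr - (?d + \<alpha>) * a"
    unfolding R_def powr_powr by (simp only: times_divide_eq_left mult_1 minus_divide_left)
  also have "\<dots> \<le> R powr - (?d + \<alpha>) * measure lborel T" by (intro mult_left_mono T) simp
  also have "\<dots> = (\<integral>y. R powr - (?d + \<alpha>) * indicator T y \<partial>lborel)" by simp
  also have "\<dots> \<le> (\<integral>y. indicator (- S) y * truncated_kernel \<alpha> \<epsilon> (y - x) \<partial>lborel)"
  proof (rule integral_mono)
    show "integrable lborel (\<lambda>y. R powr - (?d + \<alpha>) * indicator T y)"
      using fT by simp
    show "integrable lborel (\<lambda>y. indicator (- S) y * truncated_kernel \<alpha> \<epsilon> (y - x))"
      by (rule Bochner_Integration.integrable_bound[OF K]) (auto simp: indicator_def)
    fix y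
    show "R powr - (?d + \<alpha>) * indicator T y \<le> indicator (- S) y * truncated_kernel \<alpha> \<epsilon> (y - x)"
    proof (cases "y \<in> T")
      case True
      then have y: "y \<notin> S" "norm (y - x) < R" "\<epsilon> \<le> norm (y - x)"
        by (auto simp: T_def dist_norm norm_minus_commute)
      have "R powr - (?d + \<alpha>) \<le> norm (y - x) powr - (?d + \<alpha>)"
        using y \<epsilon> \<alpha> by (intro powr_mono2') auto
      then show ?thesis using True y by (simp add: truncated_kernel_def riesz_kernel_def)
    qed simp
  qed
  finally show ?thesis .
qed

lemma truncated_energy_faber_krahn:
  fixes v :: "'a::euclidean_space \<Rightarrow> real"
  assumes \<alpha>: "0 < \<alpha>" "\<alpha> < 2" and \<epsilon>: "0 < \<epsilon>"
    and v: "v \<in> test_functions D"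
    and S [measurable]: "S \<in> sets lborel" and fin: "emeasure lborel S < \<infinity>"
    and supp: "\<And>x. x \<notin> S \<Longrightarrow> v x = 0"
    and a: "measure lborel S \<le> a" "0 < a" and small: "unit_ball_vol DIM('a) * \<epsilon> ^ DIM('a) \<le> a"
  shows "faber_krahn_constant TYPE('a) \<alpha> * a powr - (\<alpha> / DIM('a)) * (\<integral>x. (v x)\<^sup>2 \<partial>lborel)
    \<le> truncated_energy \<alpha> \<epsilon> v v"
proof -
  note [measurable] = test_functions_measurable[OF v]
  obtain B where B: "\<And>x. \<bar>v x\<bar> \<le> B" using test_functions_bounded[OF v] by blast
  let ?k = "faber_krahn_constant TYPE('a) \<alpha> * a powr - (\<alpha> / DIM('a))"
  let ?G = "\<lambda>(x, y). (v x)\<^sup>2 * indicator (- S) y * truncated_kernel \<alpha> \<epsilon> (y - x)"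
  have G: "integrable (lborel \<Otimes>\<^sub>M lborel) ?G"
    using integrable_kernel_weighted[where g="\<lambda>p. indicator (- S) (snd p)" and B=1,
        OF \<alpha> \<epsilon> _ _ test_functions_integrable(2)[OF v]]
    by (simp add: indicator_def)
  have "?k * (\<integral>x. (v x)\<^sup>2 \<partial>lborel) = (\<integral>x. (v x)\<^sup>2 * ?k \<partial>lborel)" by simp
  also have "\<dots> \<le> (\<integral>x. \<integral>y. ?G (x, y) \<partial>lborel \<partial>lborel)"
  proof (rule integral_mono)
    show "integrable lborel (\<lambda>x. (v x)\<^sup>2 * ?k)"
      by (intro integrable_mult_left test_functions_integrable[OF v])
    show "integrable lborel (\<lambda>x. \<integral>y. ?G (x, y) \<partial>lborel)"
      using G by (rule lborel_pair.integrable_fst')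
    fix x
    have "(\<integral>y. ?G (x, y) \<partial>lborel)
        = (v x)\<^sup>2 * (\<integral>y. indicator (- S) y * truncated_kernel \<alpha> \<epsilon> (y - x) \<partial>lborel)"
      by (simp add: mult.assoc)
    then show "(v x)\<^sup>2 * ?k \<le> (\<integral>y. ?G (x, y) \<partial>lborel)"
      using kernel_mass_outside[OF \<alpha> \<epsilon> S fin a small, of x] by (simp add: mult_left_mono)
  qed
  also have "\<dots> = integral\<^sup>L (lborel \<Otimes>\<^sub>M lborel) ?G"
    using G by (rule lborel_pair.integral_fst')
  also have "\<dots> \<le> truncated_energy \<alpha> \<epsilon> v v"
    unfolding truncated_energy_def
  proof (rule integral_mono[OF G
        integrable_truncated_energy[OF \<alpha> \<epsilon> _ B test_functions_integrable(1)[OF v]]])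
    fix p :: "'a \<times> 'a"
    obtain x y where p: "p = (x, y)" by (cases p)
    have "(v x)\<^sup>2 * indicator (- S) y \<le> (v x - v y) * (v x - v y)"
      using supp[of y] by (cases "y \<in> S") (simp_all add: power2_eq_square)
    from mult_right_mono[OF this truncated_kernel_nonneg[of \<alpha> \<epsilon> "y - x"]]
    show "?G p \<le> (case p of (x, y) \<Rightarrow> (v x - v y) * (v x - v y) * truncated_kernel \<alpha> \<epsilon> (y - x))"
      by (simp add: p)
  qed measurable
  finally show ?thesis .
qed

lemma dirichlet_form_faber_krahn:
  fixes v :: "'a::euclidean_space \<Rightarrow> real"
  assumes \<alpha>: "0 < \<alpha>" "\<alpha> < 2" and v: "v \<in> test_functions D"
    and S: "S \<in> sets lborel" "emeasure lborel S < \<infinity>" "\<And>x. x \<notin> S \<Longrightarrow> v x = 0"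
    and a: "measure lborel S \<le> a" "0 < a"
  shows "frac_constant TYPE('a) \<alpha> / 2 * (faber_krahn_constant TYPE('a) \<alpha> * a powr - (\<alpha> / DIM('a))
      * (\<integral>x. (v x)\<^sup>2 \<partial>lborel)) \<le> dirichlet_form \<alpha> D v v"
proof (rule tendsto_lowerbound[OF dirichlet_form_limit[OF \<alpha> v v]])
  have "((\<lambda>\<epsilon>. unit_ball_vol DIM('a) * \<epsilon> ^ DIM('a)) \<longlongrightarrow> unit_ball_vol DIM('a) * 0 ^ DIM('a)) (at_right (0::real))"
    by (intro tendsto_intros)
  then have "\<forall>\<^sub>F \<epsilon> in at_right 0. unit_ball_vol DIM('a) * \<epsilon> ^ DIM('a) < a"
    using a by (intro order_tendstoD(2)) (simp_all add: power_0_left)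
  moreover have "\<forall>\<^sub>F \<epsilon> in at_right 0. (0::real) < \<epsilon>" by (rule eventually_at_right_less)
  ultimately show "\<forall>\<^sub>F \<epsilon> in at_right 0. frac_constant TYPE('a) \<alpha> / 2 *
      (faber_krahn_constant TYPE('a) \<alpha> * a powr - (\<alpha> / DIM('a)) * (\<integral>x. (v x)\<^sup>2 \<partial>lborel))
      \<le> frac_constant TYPE('a) \<alpha> / 2 * truncated_energy \<alpha> \<epsilon> v v"
  proof eventually_elim
    case (elim \<epsilon>)
    then show ?case
      using truncated_energy_faber_krahn[OF \<alpha> _ v S a] frac_constant_pos[OF \<alpha>, where 'a='a]
      by (intro mult_left_mono) auto
  qed
qed simp

text \<open>With \<open>d = u - w\<close>, the increments satisfy \<open>\<Delta>u * \<Delta>v = \<Delta>w * \<Delta>v + \<Delta>d * \<Delta>v\<close>. The first term is at least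
  \<open>(\<Delta>v)\<^sup>2\<close> because \<open>v\<close> is a monotone contraction of \<open>w\<close>, the second at least
  \<open>- ((\<Delta>v)\<^sup>2 + (\<Delta>d)\<^sup>2) / 2\<close>. In the application \<open>u\<close> and \<open>w\<close> are two members of a sequence that is Cauchy
  for the form, which makes the energy of \<open>d\<close> small.\<close>

lemma dirichlet_form_soft_cut:
  fixes u w :: "'a::euclidean_space \<Rightarrow> real"
  assumes \<alpha>: "0 < \<alpha>" "\<alpha> < 2" and h: "0 < h" and k: "0 < k"
    and u: "u \<in> test_functions D" and w: "w \<in> test_functions D"
  defines "v \<equiv> \<lambda>x. soft_cut h (w x - k)"
  shows "dirichlet_form \<alpha> D v v / 2
      - dirichlet_form \<alpha> D (\<lambda>x. u x - w x) (\<lambda>x. u x - w x) / 2 \<le> dirichlet_form \<alpha> D u v"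
proof -
  let ?C = "frac_constant TYPE('a) \<alpha> / 2"
  define d where "d = (\<lambda>x. u x - w x)"
  have v: "v \<in> test_functions D" unfolding v_def by (rule test_functions_soft_cut[OF h w k])
  have d: "d \<in> test_functions D" unfolding d_def by (rule test_functions_diff[OF u w])
  have C: "0 < ?C" using frac_constant_pos[OF \<alpha>, where 'a='a] by simp
  have int: "integrable (lborel \<Otimes>\<^sub>M lborel)
      (\<lambda>(x, y). (f x - f y) * (g x - g y) * truncated_kernel \<alpha> \<epsilon> (y - x))"
    if t: "0 < \<epsilon>" "f \<in> test_functions D" "g \<in> test_functions D" for \<epsilon> and f g :: "'a \<Rightarrow> real"
  proof -
    obtain B where "\<And>x. \<bar>f x\<bar> \<le> B" using test_functions_bounded[OF t(2)] by blast
    then show ?thesis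
      by (rule integrable_truncated_energy[OF \<alpha> t(1) test_functions_measurable[OF t(2)] _
          test_functions_integrable(1)[OF t(3)]])
  qed
  have energy: "truncated_energy \<alpha> \<epsilon> v v / 2 - truncated_energy \<alpha> \<epsilon> d d / 2
      \<le> truncated_energy \<alpha> \<epsilon> u v" if \<epsilon>: "0 < \<epsilon>" for \<epsilon>
  proof -
    let ?e = "\<lambda>f g (x, y). (f x - f y) * (g x - g y) * truncated_kernel \<alpha> \<epsilon> (y - x)"
    have "truncated_energy \<alpha> \<epsilon> v v / 2 - truncated_energy \<alpha> \<epsilon> d d / 2
        = (\<integral>p. ?e v v p / 2 - ?e d d p / 2 \<partial>(lborel \<Otimes>\<^sub>M lborel))"
      unfolding truncated_energy_def
      by (subst Bochner_Integration.integral_diff)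
        (use int[OF \<epsilon> v v] int[OF \<epsilon> d d] in \<open>auto\<close>)
    also have "\<dots> \<le> truncated_energy \<alpha> \<epsilon> u v"
      unfolding truncated_energy_def
    proof (rule integral_mono)
      show "integrable (lborel \<Otimes>\<^sub>M lborel) (\<lambda>p. ?e v v p / 2 - ?e d d p / 2)"
        using int[OF \<epsilon> v v] int[OF \<epsilon> d d]
        by (intro Bochner_Integration.integrable_diff integrable_divide)
      show "integrable (lborel \<Otimes>\<^sub>M lborel) (?e u v)" by (rule int[OF \<epsilon> u v])
      fix p :: "'a \<times> 'a"
      obtain x y where p: "p = (x, y)" by (cases p)
      have "(v x - v y) * (v x - v y) \<le> (w x - w y) * (v x - v y)"
        using soft_cut_energy[OF h, of "w x - k" "w y - k"] by (simp add: v_def power2_eq_square)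
      moreover have "V * V / 2 - e * e / 2 \<le> (e + W) * V" if "V * V \<le> W * V" for V W e :: real
      proof -
        have "0 \<le> (V + e)\<^sup>2" by simp
        then show ?thesis using that by (simp add: power2_eq_square algebra_simps)
      qed
      ultimately have "(v x - v y) * (v x - v y) / 2 - (d x - d y) * (d x - d y) / 2
          \<le> ((d x - d y) + (w x - w y)) * (v x - v y)" by blast
      then have "(v x - v y) * (v x - v y) / 2 - (d x - d y) * (d x - d y) / 2
          \<le> (u x - u y) * (v x - v y)"
        by (simp add: d_def)
      from mult_right_mono[OF this truncated_kernel_nonneg[of \<alpha> \<epsilon> "y - x"]]
      show "?e v v p / 2 - ?e d d p / 2 \<le> ?e u v p"
        by (simp add: p left_diff_distrib)
    qed
    finally show ?thesis .
  qed
  have "dirichlet_form \<alpha> D v v / 2 - dirichlet_form \<alpha> D d d / 2 \<le> dirichlet_form \<alpha> D u v"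
  proof (rule tendsto_le)
    show "((\<lambda>\<epsilon>. ?C * truncated_energy \<alpha> \<epsilon> v v / 2 - ?C * truncated_energy \<alpha> \<epsilon> d d / 2)
        \<longlongrightarrow> dirichlet_form \<alpha> D v v / 2 - dirichlet_form \<alpha> D d d / 2) (at_right 0)"
      by (intro tendsto_intros dirichlet_form_limit[OF \<alpha>] v d) simp_all
    show "((\<lambda>\<epsilon>. ?C * truncated_energy \<alpha> \<epsilon> u v) \<longlongrightarrow> dirichlet_form \<alpha> D u v) (at_right 0)"
      by (rule dirichlet_form_limit[OF \<alpha> u v])
    show "\<forall>\<^sub>F \<epsilon> in at_right 0. ?C * truncated_energy \<alpha> \<epsilon> v v / 2 - ?C * truncated_energy \<alpha> \<epsilon> d d / 2
        \<le> ?C * truncated_energy \<alpha> \<epsilon> u v"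
      using eventually_at_right_less[of "0::real"]
    proof eventually_elim
      case (elim \<epsilon>)
      from mult_left_mono[OF energy[OF this] less_imp_le[OF C]] show ?case
        by (simp add: right_diff_distrib)
    qed
  qed simp
  then show ?thesis by (simp add: d_def)
qed

section \<open>Square integrable functions\<close>

lemma integral_Cauchy_Schwarz:
  fixes f g :: "'b \<Rightarrow> real"
  assumes [measurable]: "f \<in> borel_measurable M" "g \<in> borel_measurable M"
    and f2: "integrable M (\<lambda>x. (f x)\<^sup>2)" and g2: "integrable M (\<lambda>x. (g x)\<^sup>2)"
  shows "integrable M (\<lambda>x. f x * g x)"
    and "(\<integral>x. f x * g x \<partial>M)\<^sup>2 \<le> (\<integral>x. (f x)\<^sup>2 \<partial>M) * (\<integral>x. (g x)\<^sup>2 \<partial>M)"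
proof -
  show fg: "integrable M (\<lambda>x. f x * g x)"
  proof (rule Bochner_Integration.integrable_bound[OF Bochner_Integration.integrable_add[OF f2 g2]])
    have "\<bar>f x * g x\<bar> \<le> (f x)\<^sup>2 + (g x)\<^sup>2" for x
    proof -
      have "2 * (\<bar>f x\<bar> * \<bar>g x\<bar>) \<le> (f x)\<^sup>2 + (g x)\<^sup>2"
        using sum_squares_bound[of "\<bar>f x\<bar>" "\<bar>g x\<bar>"] by (simp add: mult.assoc)
      moreover have "0 \<le> \<bar>f x\<bar> * \<bar>g x\<bar>" by simp
      ultimately show ?thesis unfolding abs_mult by linarith
    qed
    then show "AE x in M. norm (f x * g x) \<le> norm ((f x)\<^sup>2 + (g x)\<^sup>2)" by simp
  qed measurable
  define A B C where "A = (\<integral>x. (f x)\<^sup>2 \<partial>M)" and "B = (\<integral>x. f x * g x \<partial>M)" and "C = (\<integral>x. (g x)\<^sup>2 \<partial>M)"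
  have quad: "0 \<le> A - 2 * t * B + t\<^sup>2 * C" for t
  proof -
    have "0 \<le> (\<integral>x. (f x - t * g x)\<^sup>2 \<partial>M)" by simp
    also have "\<dots> = (\<integral>x. ((f x)\<^sup>2 - (2 * t) * (f x * g x)) + t\<^sup>2 * (g x)\<^sup>2 \<partial>M)"
      by (intro Bochner_Integration.integral_cong) (auto simp: power2_eq_square algebra_simps)
    also have "\<dots> = (A - (2 * t) * B) + t\<^sup>2 * C"
      using f2 g2 fg
      by (simp add: A_def B_def C_def Bochner_Integration.integral_add Bochner_Integration.integral_diff)
    finally show ?thesis by simp
  qed
  have C0: "0 \<le> C" by (simp add: C_def)
  show "B\<^sup>2 \<le> A * C"
  proof (cases "C = 0")
    case True
    have "B = 0"
    proof (rule ccontr)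
      assume "B \<noteq> 0"
      \<comment> \<open>This argument makes the affine function \<open>A - 2 * t * B\<close> equal to \<open>- 1\<close>.\<close>
      then show False using quad[of "(A + 1) / (2 * B)"] True by simp
    qed
    then show ?thesis using True by simp
  next
    case False
    then show ?thesis
      using quad[of "B / C"] C0 by (simp add: field_simps power2_eq_square)
  qed
qed

lemma tendsto_integral_mult_L2:
  fixes f g :: "'b \<Rightarrow> real" and G :: "nat \<Rightarrow> 'b \<Rightarrow> real"
  assumes [measurable]: "f \<in> borel_measurable M" "g \<in> borel_measurable M"
      "\<And>n. G n \<in> borel_measurable M"
    and f2: "integrable M (\<lambda>x. (f x)\<^sup>2)" and g2: "integrable M (\<lambda>x. (g x)\<^sup>2)"
    and G2: "\<And>n. integrable M (\<lambda>x. (G n x)\<^sup>2)"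
    and d2: "\<And>n. integrable M (\<lambda>x. (G n x - g x)\<^sup>2)"
    and lim: "(\<lambda>n. \<integral>x. (G n x - g x)\<^sup>2 \<partial>M) \<longlonglongrightarrow> 0"
  shows "(\<lambda>n. \<integral>x. f x * G n x \<partial>M) \<longlonglongrightarrow> (\<integral>x. f x * g x \<partial>M)"
proof -
  have "(\<lambda>n. (\<integral>x. f x * (G n x - g x) \<partial>M)\<^sup>2) \<longlonglongrightarrow> 0"
  proof (rule tendsto_sandwich[where f="\<lambda>_. 0"])
    show "\<forall>\<^sub>F n in sequentially. (\<integral>x. f x * (G n x - g x) \<partial>M)\<^sup>2
        \<le> (\<integral>x. (f x)\<^sup>2 \<partial>M) * (\<integral>x. (G n x - g x)\<^sup>2 \<partial>M)"
      by (intro always_eventually allI integral_Cauchy_Schwarz f2 d2) measurable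
    show "(\<lambda>n. (\<integral>x. (f x)\<^sup>2 \<partial>M) * (\<integral>x. (G n x - g x)\<^sup>2 \<partial>M)) \<longlonglongrightarrow> 0"
      using tendsto_mult_left[OF lim] by simp
  qed auto
  then have "(\<lambda>n. \<integral>x. f x * (G n x - g x) \<partial>M) \<longlonglongrightarrow> 0"
    using tendsto_real_sqrt by (simp add: tendsto_rabs_zero_iff)
  moreover have "(\<integral>x. f x * (G n x - g x) \<partial>M) = (\<integral>x. f x * G n x \<partial>M) - (\<integral>x. f x * g x \<partial>M)" for n
    using integral_Cauchy_Schwarz(1)[of f M "G n"] integral_Cauchy_Schwarz(1)[of f M g] f2 g2 G2
    by (simp add: right_diff_distrib Bochner_Integration.integral_diff)
  ultimately show ?thesis by (simp add: LIM_zero_iff)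
qed

lemma tendsto_integral_square_L2:
  fixes g :: "'b \<Rightarrow> real" and G :: "nat \<Rightarrow> 'b \<Rightarrow> real"
  assumes [measurable]: "g \<in> borel_measurable M" "\<And>n. G n \<in> borel_measurable M"
    and g2: "integrable M (\<lambda>x. (g x)\<^sup>2)" and G2: "\<And>n. integrable M (\<lambda>x. (G n x)\<^sup>2)"
    and d2: "\<And>n. integrable M (\<lambda>x. (G n x - g x)\<^sup>2)"
    and lim: "(\<lambda>n. \<integral>x. (G n x - g x)\<^sup>2 \<partial>M) \<longlonglongrightarrow> 0"
  shows "(\<lambda>n. \<integral>x. (G n x)\<^sup>2 \<partial>M) \<longlonglongrightarrow> (\<integral>x. (g x)\<^sup>2 \<partial>M)"
proof -
  have gG: "integrable M (\<lambda>x. g x * G n x)" for n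
    using g2 G2 by (intro integral_Cauchy_Schwarz) auto
  have "(\<integral>x. (G n x)\<^sup>2 \<partial>M) = (\<integral>x. (G n x - g x)\<^sup>2 \<partial>M)
      + 2 * (\<integral>x. g x * G n x \<partial>M) - (\<integral>x. (g x)\<^sup>2 \<partial>M)" for n
  proof -
    have "(\<integral>x. (G n x)\<^sup>2 \<partial>M) = (\<integral>x. ((G n x - g x)\<^sup>2 + 2 * (g x * G n x)) - (g x)\<^sup>2 \<partial>M)"
      by (intro Bochner_Integration.integral_cong) (auto simp: power2_eq_square algebra_simps)
    also have "\<dots> = ((\<integral>x. (G n x - g x)\<^sup>2 \<partial>M) + 2 * (\<integral>x. g x * G n x \<partial>M)) - (\<integral>x. (g x)\<^sup>2 \<partial>M)"
      using d2[of n] gG[of n] g2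
      by (subst Bochner_Integration.integral_diff Bochner_Integration.integral_add; simp)+
    finally show ?thesis .
  qed
  moreover have "(\<lambda>n. (\<integral>x. (G n x - g x)\<^sup>2 \<partial>M) + 2 * (\<integral>x. g x * G n x \<partial>M) - (\<integral>x. (g x)\<^sup>2 \<partial>M))
      \<longlonglongrightarrow> 0 + 2 * (\<integral>x. g x * g x \<partial>M) - (\<integral>x. (g x)\<^sup>2 \<partial>M)"
    by (intro tendsto_intros lim tendsto_integral_mult_L2 g2 G2 d2) measurable
  ultimately show ?thesis by (simp add: power2_eq_square)
qed

lemma integrable_square_diff:
  fixes f g :: "'b \<Rightarrow> real"
  assumes [measurable]: "f \<in> borel_measurable M" "g \<in> borel_measurable M"
    and f2: "integrable M (\<lambda>x. (f x)\<^sup>2)" and g2: "integrable M (\<lambda>x. (g x)\<^sup>2)"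
  shows "integrable M (\<lambda>x. (f x - g x)\<^sup>2)"
proof -
  have "integrable M (\<lambda>x. ((f x)\<^sup>2 - 2 * (f x * g x)) + (g x)\<^sup>2)"
    by (intro Bochner_Integration.integrable_add Bochner_Integration.integrable_diff
        integrable_mult_right integral_Cauchy_Schwarz f2 g2) measurable
  then show ?thesis by (simp add: power2_eq_square algebra_simps)
qed

lemma Markov_measure:
  fixes g :: "'b \<Rightarrow> real"
  assumes T: "T \<in> sets M" and g: "integrable M g" "\<And>x. 0 \<le> g x"
    and c: "0 < c" "\<And>x. x \<in> T \<Longrightarrow> c \<le> g x"
  shows "T \<in> fmeasurable M" and "measure M T \<le> (\<integral>x. g x \<partial>M) / c"
proof -
  have le: "c * indicator T x \<le> g x" for x
    using g(2)[of x] c(2)[of x] by (simp add: indicator_def)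
  have int: "integrable M (\<lambda>x. c * indicator T x)"
    by (rule Bochner_Integration.integrable_bound[OF g(1)])
      (use T le c g(2) in \<open>auto simp: abs_mult\<close>)
  then have i: "integrable M (indicator T :: 'b \<Rightarrow> real)" using c by simp
  then show T': "T \<in> fmeasurable M"
    using T sets.sets_into_space[OF T] by (simp add: fmeasurable_def integrable_indicator_iff Int_absorb2 Int_absorb1)
  have "c * measure M T = (\<integral>x. c * indicator T x \<partial>M)"
    using T sets.sets_into_space[OF T] by (simp add: Int_absorb1 Int_absorb2)
  also have "\<dots> \<le> (\<integral>x. g x \<partial>M)"
    using int g(1) le by (rule integral_mono)
  finally show "measure M T \<le> (\<integral>x. g x \<partial>M) / c" using c by (simp add: field_simps)
qed

lemma superlevel_fmeasurable:
  assumes [measurable]: "f \<in> borel_measurable M" and f2: "integrable M (\<lambda>x. (f x :: real)\<^sup>2)"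
    and l: "0 < l"
  shows "{x \<in> space M. l < f x} \<in> fmeasurable M"
    and "measure M {x \<in> space M. l < f x} \<le> (\<integral>x. (f x)\<^sup>2 \<partial>M) / l\<^sup>2"
proof -
  have "l\<^sup>2 \<le> (f x)\<^sup>2" if "x \<in> {x \<in> space M. l < f x}" for x
    using that l by (intro power_mono) auto
  moreover have "{x \<in> space M. l < f x} \<in> sets M" by measurable
  ultimately show "{x \<in> space M. l < f x} \<in> fmeasurable M"
    and "measure M {x \<in> space M. l < f x} \<le> (\<integral>x. (f x)\<^sup>2 \<partial>M) / l\<^sup>2"
    using l by (intro Markov_measure[OF _ f2, where c="l\<^sup>2"]; simp)+
qed

section \<open>Truncation inequality for eigenfunctions\<close>

lemma soft_cut_measurable [measurable]: "soft_cut h \<in> borel_measurable borel"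
  unfolding soft_cut_def flat_exp_def by measurable

lemma soft_cut_square_integrable:
  assumes h: "0 < h" and k: "0 < k"
    and [measurable]: "f \<in> borel_measurable M" and f2: "integrable M (\<lambda>x. (f x :: real)\<^sup>2)"
  shows "integrable M (\<lambda>x. (soft_cut h (f x - k))\<^sup>2)"
proof (rule Bochner_Integration.integrable_bound[OF f2])
  have "\<bar>soft_cut h (f x - k)\<bar> \<le> \<bar>f x\<bar>" for x
    using soft_cut_contraction[OF h, of "f x - k" 0] soft_cut_nonneg[OF h, of "f x - k"] k
      soft_cut_nonpos[OF h, of 0] soft_cut_nonpos[OF h, of "f x - k"]
    by (cases "f x \<le> k") auto
  then show "AE x in M. norm ((soft_cut h (f x - k))\<^sup>2) \<le> norm ((f x)\<^sup>2)"
    by (simp add: abs_le_square_iff)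
qed measurable

text \<open>Testing the eigenvalue equation with the truncation of \<open>f\<close> itself would require this truncation to
  be approximated in energy. Instead, the equation is tested with the truncation \<open>V m\<close> of the
  approximant \<open>u m\<close>: first \<open>n \<longlongrightarrow> \<infinity>\<close> in the form of \<open>u n\<close> and \<open>V m\<close>, which by
  \<open>dirichlet_form_soft_cut\<close> dominates half the energy of \<open>V m\<close> up to a small error, and then
  \<open>m \<longlongrightarrow> \<infinity>\<close> in \<open>L\<^sup>2\<close> only. The Faber--Krahn inequality is applied to \<open>V m\<close>, whose support lies
  in \<open>{x. k < u m x}\<close>; up to a set of small measure, this is contained in \<open>{x. k - h < f x}\<close>.\<close>

lemma eigenfunction_truncation_inequality:
  fixes f :: "'a::euclidean_space \<Rightarrow> real"
  assumes \<alpha>: "0 < \<alpha>" "\<alpha> < 2"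
    and f [measurable]: "f \<in> borel_measurable borel" and f2: "integrable lborel (\<lambda>x. (f x)\<^sup>2)"
    and u: "\<And>n. u n \<in> test_functions D"
    and conv: "(\<lambda>n. \<integral>x. (u n x - f x)\<^sup>2 \<partial>lborel) \<longlonglongrightarrow> 0"
    and cauchy: "\<And>e. 0 < e \<Longrightarrow> \<exists>N. \<forall>m\<ge>N. \<forall>n\<ge>N.
        dirichlet_form \<alpha> D (\<lambda>x. u m x - u n x) (\<lambda>x. u m x - u n x) < e"
    and eigen: "\<And>g. g \<in> test_functions D \<Longrightarrow>
        (\<lambda>n. dirichlet_form \<alpha> D (u n) g) \<longlonglongrightarrow> lam * (\<integral>x. f x * g x \<partial>lborel)"
    and h: "0 < h" "h < k" and a: "measure lborel {x. k - h < f x} < a"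
  shows "frac_constant TYPE('a) \<alpha> / 4 * faber_krahn_constant TYPE('a) \<alpha> * a powr - (\<alpha> / DIM('a))
      * (\<integral>x. (soft_cut h (f x - k))\<^sup>2 \<partial>lborel) \<le> lam * (\<integral>x. f x * soft_cut h (f x - k) \<partial>lborel)"
proof -
  note um [measurable] = test_functions_measurable[OF u]
  have k: "0 < k" using h by simp
  have a0: "0 < a" using a by (rule le_less_trans[OF measure_nonneg])
  define v where "v = (\<lambda>x. soft_cut h (f x - k))"
  define V where "V = (\<lambda>m x. soft_cut h (u m x - k))"
  have [measurable]: "v \<in> borel_measurable borel" "V m \<in> borel_measurable borel" for m
    unfolding v_def V_def by measurable
  have Vt: "V m \<in> test_functions D" for m
    unfolding V_def by (rule test_functions_soft_cut[OF h(1) u k])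
  have v2: "integrable lborel (\<lambda>x. (v x)\<^sup>2)"
    unfolding v_def by (rule soft_cut_square_integrable[OF h(1) k _ f2]) measurable
  have V2: "integrable lborel (\<lambda>x. (V m x)\<^sup>2)" for m
    by (rule test_functions_integrable[OF Vt])
  have d2: "integrable lborel (\<lambda>x. (u m x - f x)\<^sup>2)" for m
    by (intro integrable_square_diff f2 test_functions_integrable[OF u]) measurable
  have D2: "integrable lborel (\<lambda>x. (V m x - v x)\<^sup>2)" for m
    by (intro integrable_square_diff v2 V2) measurable
  have Vconv: "(\<lambda>m. \<integral>x. (V m x - v x)\<^sup>2 \<partial>lborel) \<longlonglongrightarrow> 0"
  proof (rule tendsto_sandwich[where f="\<lambda>_. 0", OF _ _ tendsto_const conv])
    show "\<forall>\<^sub>F m in sequentially. (\<integral>x. (V m x - v x)\<^sup>2 \<partial>lborel) \<le> (\<integral>x. (u m x - f x)\<^sup>2 \<partial>lborel)"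
    proof (intro always_eventually allI integral_mono D2 d2)
      fix m x
      have "\<bar>V m x - v x\<bar> \<le> \<bar>u m x - f x\<bar>"
        using soft_cut_contraction[OF h(1), of "u m x - k" "f x - k"] by (simp add: V_def v_def)
      then show "(V m x - v x)\<^sup>2 \<le> (u m x - f x)\<^sup>2" by (simp add: abs_le_square_iff)
    qed
  qed simp
  define S where "S = {x. k - h < f x}"
  have [measurable]: "S \<in> sets borel" unfolding S_def by measurable
  have S: "S \<in> fmeasurable lborel"
    using superlevel_fmeasurable(1)[of f lborel "k - h"] f2 h by (simp add: S_def)
  have small: "\<forall>\<^sub>F m in sequentially. (\<integral>x. (u m x - f x)\<^sup>2 \<partial>lborel) < h\<^sup>2 * (a - measure lborel S)"
    using conv by (rule order_tendstoD) (use a h in \<open>simp add: S_def\<close>)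
  have FK: "frac_constant TYPE('a) \<alpha> / 2 * (faber_krahn_constant TYPE('a) \<alpha> * a powr - (\<alpha> / DIM('a))
      * (\<integral>x. (V m x)\<^sup>2 \<partial>lborel)) \<le> dirichlet_form \<alpha> D (V m) (V m)"
    if "(\<integral>x. (u m x - f x)\<^sup>2 \<partial>lborel) < h\<^sup>2 * (a - measure lborel S)" for m
  proof -
    define S' where "S' = {x. k < u m x}"
    have [measurable]: "S' \<in> sets borel" unfolding S'_def by measurable
    have T: "S' - S \<in> fmeasurable lborel"
      "measure lborel (S' - S) \<le> (\<integral>x. (u m x - f x)\<^sup>2 \<partial>lborel) / h\<^sup>2"
    proof -
      have "h\<^sup>2 \<le> (u m x - f x)\<^sup>2" if "x \<in> S' - S" for x
        using that h by (intro power_mono) (auto simp: S_def S'_def)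
      then show "S' - S \<in> fmeasurable lborel"
        "measure lborel (S' - S) \<le> (\<integral>x. (u m x - f x)\<^sup>2 \<partial>lborel) / h\<^sup>2"
        using Markov_measure[OF _ d2[of m], where T="S' - S" and c="h\<^sup>2"] h by auto
    qed
    have S'sub: "S' \<subseteq> S \<union> (S' - S)" by blast
    have U: "S \<union> (S' - S) \<in> fmeasurable lborel" using S T(1) by (rule fmeasurable.Un)
    show ?thesis
    proof (rule dirichlet_form_faber_krahn[OF \<alpha> Vt])
      show "S' \<in> sets lborel" by simp
      have "S' \<in> fmeasurable lborel" using U S'sub by (rule fmeasurableI2) simp
      then show "emeasure lborel S' < \<infinity>" by (simp add: fmeasurable_def)
      show "V m x = 0" if "x \<notin> S'" for x
        using that soft_cut_nonpos[OF h(1), of "u m x - k"] by (simp add: V_def S'_def)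
      have "measure lborel S' \<le> measure lborel (S \<union> (S' - S))"
        by (rule measure_mono_fmeasurable[OF S'sub _ U]) simp
      also have "\<dots> \<le> measure lborel S + measure lborel (S' - S)"
        by (rule measure_Un_le) simp_all
      also have "measure lborel (S' - S) \<le> a - measure lborel S"
      proof -
        have "h\<^sup>2 * measure lborel (S' - S) \<le> (\<integral>x. (u m x - f x)\<^sup>2 \<partial>lborel)"
          using T(2) h by (simp add: field_simps)
        then have "h\<^sup>2 * measure lborel (S' - S) < h\<^sup>2 * (a - measure lborel S)"
          using that by (rule le_less_trans)
        then show ?thesis using h by simp
      qed
      finally show "measure lborel S' \<le> a" by simp
    qed (rule a0)
  qed
  define c where "c = frac_constant TYPE('a) \<alpha> / 4 * faber_krahn_constant TYPE('a) \<alpha> * a powr - (\<alpha> / DIM('a))"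
  have "c * (\<integral>x. (v x)\<^sup>2 \<partial>lborel) \<le> lam * (\<integral>x. f x * v x \<partial>lborel) + e" if e: "0 < e" for e
  proof -
    obtain N where N: "\<And>m n. N \<le> m \<Longrightarrow> N \<le> n \<Longrightarrow>
        dirichlet_form \<alpha> D (\<lambda>x. u m x - u n x) (\<lambda>x. u m x - u n x) < e"
      using cauchy[OF e] by blast
    have ev: "c * (\<integral>x. (V m x)\<^sup>2 \<partial>lborel) - e \<le> lam * (\<integral>x. f x * V m x \<partial>lborel)"
      if m: "N \<le> m" "(\<integral>x. (u m x - f x)\<^sup>2 \<partial>lborel) < h\<^sup>2 * (a - measure lborel S)" for m
    proof (rule tendsto_lowerbound[OF eigen[OF Vt]])
      show "\<forall>\<^sub>F n in sequentially. c * (\<integral>x. (V m x)\<^sup>2 \<partial>lborel) - e \<le> dirichlet_form \<alpha> D (u n) (V m)"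
        using eventually_ge_at_top[of N]
      proof eventually_elim
        case (elim n)
        have "c * (\<integral>x. (V m x)\<^sup>2 \<partial>lborel) \<le> dirichlet_form \<alpha> D (V m) (V m) / 2"
          using FK[OF m(2)] by (simp add: c_def mult_ac)
        moreover have "dirichlet_form \<alpha> D (V m) (V m) / 2
            - dirichlet_form \<alpha> D (\<lambda>x. u n x - u m x) (\<lambda>x. u n x - u m x) / 2
            \<le> dirichlet_form \<alpha> D (u n) (V m)"
          unfolding V_def by (rule dirichlet_form_soft_cut[OF \<alpha> h(1) k u u])
        ultimately show ?case using N[OF elim m(1)] e by linarith
      qed
    qed simp
    have "c * (\<integral>x. (v x)\<^sup>2 \<partial>lborel) - e \<le> lam * (\<integral>x. f x * v x \<partial>lborel)"
    proof (rule tendsto_le[OF sequentially_bot])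
      show "(\<lambda>m. lam * (\<integral>x. f x * V m x \<partial>lborel)) \<longlonglongrightarrow> lam * (\<integral>x. f x * v x \<partial>lborel)"
        by (intro tendsto_mult_left tendsto_integral_mult_L2 f2 v2 V2 D2 Vconv) measurable
      show "(\<lambda>m. c * (\<integral>x. (V m x)\<^sup>2 \<partial>lborel) - e) \<longlonglongrightarrow> c * (\<integral>x. (v x)\<^sup>2 \<partial>lborel) - e"
        by (intro tendsto_diff tendsto_const tendsto_mult_left tendsto_integral_square_L2 v2 V2 D2 Vconv)
          measurable
      show "\<forall>\<^sub>F m in sequentially. c * (\<integral>x. (V m x)\<^sup>2 \<partial>lborel) - e \<le> lam * (\<integral>x. f x * V m x \<partial>lborel)"
        using small eventually_ge_at_top[of N] by eventually_elim (rule ev)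
    qed
    then show ?thesis by simp
  qed
  then show ?thesis unfolding c_def v_def by (rule field_le_epsilon)
qed

section \<open>De Giorgi iteration\<close>

text \<open>The truncation inequality controls the measure of a superlevel set by
  a power larger than one of the measure of a lower one, and this forces the measure to vanish at a
  finite height.\<close>

lemma superlevel_le_soft_cut:
  assumes h: "0 < h" and k: "0 < k"
    and f [measurable]: "f \<in> borel_measurable M" and f2: "integrable M (\<lambda>x. (f x :: real)\<^sup>2)"
  shows "measure M {x \<in> space M. k + h < f x}
    \<le> (\<integral>x. (soft_cut h (f x - k))\<^sup>2 \<partial>M) / (exp (- 1) * h)\<^sup>2"
proof (rule Markov_measure(2)[OF _ soft_cut_square_integrable[OF h k f f2]])
  show "{x \<in> space M. k + h < f x} \<in> sets M" by measurable
  show "0 < (exp (- 1) * h)\<^sup>2" using h by simp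
  fix x
  assume "x \<in> {x \<in> space M. k + h < f x}"
  then have x: "h \<le> f x - k" by simp
  then have "exp (- 1) * h \<le> exp (- 1) * (f x - k)" by simp
  also have "\<dots> \<le> soft_cut h (f x - k)" by (rule soft_cut_ge[OF h x])
  finally show "(exp (- 1) * h)\<^sup>2 \<le> (soft_cut h (f x - k))\<^sup>2" using h by (intro power_mono) auto
qed simp

context
  fixes M :: "'b measure" and f :: "'b \<Rightarrow> real" and lam \<kappa> \<beta> :: real
  assumes f [measurable]: "f \<in> borel_measurable M" and f2: "integrable M (\<lambda>x. (f x)\<^sup>2)"
    and lam: "0 < lam" and \<kappa>: "0 < \<kappa>" and \<beta>: "0 < \<beta>"
    and truncation: "\<And>h k a. 0 < h \<Longrightarrow> h < k \<Longrightarrow> measure M {x \<in> space M. k - h < f x} < a \<Longrightarrow>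
      \<kappa> * a powr - \<beta> * (\<integral>x. (soft_cut h (f x - k))\<^sup>2 \<partial>M)
        \<le> lam * (\<integral>x. f x * soft_cut h (f x - k) \<partial>M)"
begin

text \<open>On the right of the truncation inequality, \<open>f * F\<close> is at most \<open>exp 1 * F\<^sup>2 + (k + h) * F\<close>. By the smallness
  assumption the quadratic part is absorbed on the left. The linear part is bounded by
  \<open>F \<le> s / 2 + F\<^sup>2 / (2 * s)\<close> on the superlevel set, which is where its measure \<open>a\<close> enters a second time.\<close>

lemma superlevel_decay:
  assumes h: "0 < h" "h < k" and a: "measure M {x \<in> space M. k - h < f x} < a"
    and small: "2 * exp 1 * lam \<le> \<kappa> * a powr - \<beta>"
  shows "measure M {x \<in> space M. k + h < f x}
    \<le> (2 * exp 1 * (lam / \<kappa>) * ((k + h) / h) * a powr \<beta>)\<^sup>2 * a"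
proof -
  have k: "0 < k" using h by simp
  have a0: "0 < a" using a by (rule le_less_trans[OF measure_nonneg])
  define S where "S = {x \<in> space M. k - h < f x}"
  have S: "S \<in> fmeasurable M" unfolding S_def using h by (intro superlevel_fmeasurable f f2) simp
  have Sm [measurable]: "S \<in> sets M" using S by (rule fmeasurableD)
  define F where "F = (\<lambda>x. soft_cut h (f x - k))"
  have [measurable]: "F \<in> borel_measurable M" unfolding F_def by measurable
  have F0: "0 \<le> F x" for x by (simp add: F_def soft_cut_nonneg[OF h(1)])
  have Foff: "F x = 0" if "x \<in> space M" "x \<notin> S" for x
    using that h soft_cut_nonpos[OF h(1), of "f x - k"] by (simp add: F_def S_def)
  have F2: "integrable M (\<lambda>x. (F x)\<^sup>2)"
    unfolding F_def by (rule soft_cut_square_integrable[OF h(1) k f f2])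
  define X where "X = (\<integral>x. (F x)\<^sup>2 \<partial>M)"
  have X0: "0 \<le> X" by (simp add: X_def)
  define q where "q = a powr \<beta>"
  have q: "0 < q" using a0 by (simp add: q_def)
  have qi: "a powr - \<beta> = 1 / q" by (simp add: q_def powr_minus_divide)
  \<comment> \<open>With this \<open>s\<close>, the term with \<open>X / (2 * s)\<close> is a quarter of the left-hand side \<open>\<kappa> / q * X\<close>.\<close>
  define s where "s = 2 * lam * (k + h) * q / \<kappa>"
  have s: "0 < s" using lam \<kappa> q h k by (simp add: s_def)
  have Sint: "integrable M (indicator S :: 'b \<Rightarrow> real)"
    using S by (simp add: fmeasurable_def integrable_indicator_iff)
  have Fle: "F x \<le> (s / 2) * indicator S x + (F x)\<^sup>2 / (2 * s)" if "x \<in> space M" for x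
  proof (cases "x \<in> S")
    case True
    have "0 \<le> (F x - s)\<^sup>2" by simp
    then show ?thesis using True s by (simp add: field_simps power2_eq_square)
  qed (use Foff[OF that] in simp)
  have Fint: "integrable M F"
    by (rule Bochner_Integration.integrable_bound[OF
          Bochner_Integration.integrable_add[OF integrable_mult_right[OF Sint, of "s / 2"]
            integrable_divide[OF F2, of "2 * s"]]])
      (use F0 Fle s in \<open>auto intro!: AE_I2 order.trans[OF Fle abs_ge_self]\<close>)
  have intF: "(\<integral>x. F x \<partial>M) \<le> (s / 2) * a + X / (2 * s)"
  proof -
    have "(\<integral>x. F x \<partial>M) \<le> (\<integral>x. (s / 2) * indicator S x + (F x)\<^sup>2 / (2 * s) \<partial>M)"
      by (rule integral_mono[OF Fint _ Fle])
        (intro Bochner_Integration.integrable_add integrable_mult_right integrable_divide Sint F2)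
    also have "\<dots> = (s / 2) * measure M S + X / (2 * s)"
      using Sint F2 sets.sets_into_space[OF Sm]
      by (simp add: X_def Bochner_Integration.integral_add Int_absorb1 Int_absorb2)
    also have "\<dots> \<le> (s / 2) * a + X / (2 * s)"
      using a s by (intro add_right_mono mult_left_mono) (auto simp: S_def)
    finally show ?thesis .
  qed
  have "\<kappa> / q * X \<le> lam * (\<integral>x. f x * F x \<partial>M)"
    using truncation[OF h a] by (simp add: F_def X_def qi)
  also have "\<dots> \<le> lam * (exp 1 * X + (k + h) * (\<integral>x. F x \<partial>M))"
  proof (rule mult_left_mono)
    have "(\<integral>x. f x * F x \<partial>M) \<le> (\<integral>x. exp 1 * (F x)\<^sup>2 + (k + h) * F x \<partial>M)"
    proof (rule integral_mono)
      show "integrable M (\<lambda>x. f x * F x)" by (intro integral_Cauchy_Schwarz f2 F2) measurable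
      show "integrable M (\<lambda>x. exp 1 * (F x)\<^sup>2 + (k + h) * F x)"
        by (intro Bochner_Integration.integrable_add integrable_mult_right F2 Fint)
      fix x
      show "f x * F x \<le> exp 1 * (F x)\<^sup>2 + (k + h) * F x"
        using mult_soft_cut_le[OF h(1), of "f x - k"] by (simp add: F_def algebra_simps)
    qed
    also have "\<dots> = exp 1 * X + (k + h) * (\<integral>x. F x \<partial>M)"
      using F2 Fint by (simp add: X_def Bochner_Integration.integral_add)
    finally show "(\<integral>x. f x * F x \<partial>M) \<le> exp 1 * X + (k + h) * (\<integral>x. F x \<partial>M)" .
  qed (use lam in simp)
  also have "\<dots> \<le> \<kappa> / q * X / 2 + lam * (k + h) * ((s / 2) * a + X / (2 * s))"
  proof -
    have "2 * exp 1 * lam * X \<le> \<kappa> / q * X"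
      using small X0 by (intro mult_right_mono) (simp_all add: qi)
    moreover have "lam * (k + h) * (\<integral>x. F x \<partial>M) \<le> lam * (k + h) * ((s / 2) * a + X / (2 * s))"
      using lam k h by (intro mult_left_mono intF) simp
    moreover have "lam * (exp 1 * X + (k + h) * (\<integral>x. F x \<partial>M))
        = 2 * exp 1 * lam * X / 2 + lam * (k + h) * (\<integral>x. F x \<partial>M)"
      by (simp add: algebra_simps)
    moreover have "L \<le> P / 2 + R" if "A \<le> P" "B \<le> R" "L = A / 2 + B" for L A B P R :: real
      using that by linarith
    ultimately show ?thesis by blast
  qed
  also have "lam * (k + h) * ((s / 2) * a + X / (2 * s)) = lam\<^sup>2 * (k + h)\<^sup>2 * q * a / \<kappa> + \<kappa> / q * X / 4"
  proof -
    define t where "t = k + h"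
    have "t \<noteq> 0" using k h by (simp add: t_def)
    then have "lam * t * (X / (2 * s)) = \<kappa> / q * X / 4"
      "lam * t * (s / 2 * a) = lam\<^sup>2 * t\<^sup>2 * q * a / \<kappa>"
      using lam \<kappa> q by (simp_all add: s_def t_def[symmetric] power2_eq_square mult.commute)
    then show ?thesis by (simp only: t_def[symmetric] distrib_left)
  qed
  finally have *: "\<kappa> / q * X \<le> \<kappa> / q * X / 2 + (lam\<^sup>2 * (k + h)\<^sup>2 * q * a / \<kappa> + \<kappa> / q * X / 4)" .
  have "Y \<le> 4 * Z" if "Y \<le> Y / 2 + (Z + Y / 4)" for Y Z :: real
    using that by linarith
  from this[OF *] have "\<kappa> / q * X * (q / \<kappa>) \<le> 4 * (lam\<^sup>2 * (k + h)\<^sup>2 * q * a / \<kappa>) * (q / \<kappa>)"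
    using q \<kappa> by (intro mult_right_mono) simp_all
  then have X: "X \<le> 4 * lam\<^sup>2 * (k + h)\<^sup>2 * q\<^sup>2 * a / \<kappa>\<^sup>2"
    using q \<kappa> by (simp add: power2_eq_square ac_simps)
  have "measure M {x \<in> space M. k + h < f x} \<le> X / (exp (- 1) * h)\<^sup>2"
    unfolding X_def F_def by (rule superlevel_le_soft_cut[OF h(1) k f f2])
  also have "\<dots> \<le> (4 * lam\<^sup>2 * (k + h)\<^sup>2 * q\<^sup>2 * a / \<kappa>\<^sup>2) / (exp (- 1) * h)\<^sup>2"
    by (intro divide_right_mono X) simp
  also have "\<dots> = (2 * exp 1 * (lam / \<kappa>) * ((k + h) / h) * q)\<^sup>2 * a"
    using h \<kappa> by (simp add: exp_minus field_simps power2_eq_square)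
  finally show ?thesis by (simp add: q_def)
qed

text \<open>The levels \<open>l n\<close> increase from \<open>K\<close> to \<open>2 * K\<close> and the measures of the superlevel sets decay at least like
  \<open>b * r ^ n\<close>. Consecutive levels are \<open>2 * h\<close> apart, with \<open>(l n + 2 * h) / h\<close> at most \<open>8 * 2 ^ n\<close>. The ratio
  \<open>r = 2 powr - (1 / \<beta>)\<close> makes \<open>(r ^ n) powr \<beta> = 2 ^ (- n)\<close>, which cancels this growth.\<close>

lemma superlevel_null:
  assumes K: "0 < K"
    and start: "2 * ((\<integral>x. (f x)\<^sup>2 \<partial>M) / K\<^sup>2) \<le> (2 powr - (1 / (2 * \<beta>)) / (32 * exp 1) * \<kappa> / lam) powr (1 / \<beta>)"
  shows "measure M {x \<in> space M. 2 * K < f x} = 0"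
proof -
  define \<theta> where "\<theta> = 2 powr - (1 / (2 * \<beta>)) / (32 * exp (1::real))"
  have \<theta>: "0 < \<theta>" by (simp add: \<theta>_def)
  define b where "b = (\<theta> * \<kappa> / lam) powr (1 / \<beta>) / 2"
  have b: "0 < b" using \<theta> \<kappa> lam by (simp add: b_def)
  define r where "r = 2 powr - (1 / \<beta>)"
  have r: "0 < r" "r < 1" using \<beta> by (simp_all add: r_def powr_less_one)
  have b\<beta>: "(2 * (b * r ^ n)) powr \<beta> = \<theta> * \<kappa> / lam * (1 / 2) ^ n" for n
  proof -
    have "r ^ n = r powr real n" using r by (simp add: powr_realpow)
    then have "(r ^ n) powr \<beta> = 2 powr - real n"
      using \<beta> by (simp add: r_def powr_powr)
    also have "\<dots> = (1 / 2) ^ n" by (simp add: powr_minus powr_realpow power_one_over field_simps)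
    finally have 1: "(r ^ n) powr \<beta> = (1 / 2) ^ n" .
    have "(2 * b) powr \<beta> = \<theta> * \<kappa> / lam"
      using \<beta> \<theta> \<kappa> lam by (simp add: b_def powr_powr)
    then show ?thesis using powr_mult[of "2 * b" "r ^ n" \<beta>] b r 1 by (simp add: mult.assoc)
  qed
  define l where "l = (\<lambda>n. K * (2 - (1 / 2) ^ n))"
  have level: "measure M {x \<in> space M. l n < f x} \<le> b * r ^ n" for n
  proof (induction n)
    case 0
    have "measure M {x \<in> space M. K < f x} \<le> (\<integral>x. (f x)\<^sup>2 \<partial>M) / K\<^sup>2"
      by (rule superlevel_fmeasurable[OF f f2 K])
    also have "\<dots> \<le> b" using start unfolding b_def \<theta>_def by linarith
    finally show ?case by (simp add: l_def)
  next
    case (Suc n)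
    \<comment> \<open>Half the distance of consecutive levels, so that \<open>k - h = l n\<close> and \<open>k + h = l (Suc n)\<close>.\<close>
    define h where "h = K * (1 / 2) ^ n / 4"
    define k where "k = l n + h"
    \<comment> \<open>The factor \<open>2\<close> makes the bound on the superlevel set strict.\<close>
    define a where "a = 2 * (b * r ^ n)"
    have p: "(0::real) < (1 / 2) ^ n" "(1 / 2) ^ n \<le> (1::real)" by (simp_all add: power_le_one)
    have h: "0 < h" using K by (simp add: h_def)
    have ln: "0 < l n" using K p(2) by (simp add: l_def)
    have kh: "k - h = l n" "k + h = l (Suc n)" "h < k"
      using ln by (simp_all add: k_def h_def l_def field_simps)
    have ba: "a powr \<beta> = \<theta> * \<kappa> / lam * (1 / 2) ^ n" unfolding a_def by (rule b\<beta>)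
    have "0 < b * r ^ n" using b r by simp
    then have am: "measure M {x \<in> space M. k - h < f x} < a"
      using Suc.IH by (simp add: kh a_def)
    have \<theta>32: "32 * exp 1 * \<theta> = 2 powr - (1 / (2 * \<beta>))" by (simp add: \<theta>_def)
    have small: "2 * exp 1 * lam \<le> \<kappa> * a powr - \<beta>"
    proof -
      have "2 powr - (1 / (2 * \<beta>)) \<le> 1" using \<beta> by (intro less_imp_le powr_less_one) auto
      then have "32 * (exp 1 * \<theta>) \<le> 1" using \<theta>32 by simp
      then have "2 * (exp 1 * \<theta>) * (1 / 2) ^ n \<le> 1 * 1"
        using p \<theta> by (intro mult_mono) auto
      then have "2 * exp 1 * lam * a powr \<beta> \<le> \<kappa>"
        unfolding ba using lam \<kappa> by (simp add: field_simps)
      moreover have "0 < a powr \<beta>" unfolding ba using \<theta> \<kappa> lam p by simp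
      ultimately show ?thesis by (simp add: powr_minus_divide field_simps)
    qed
    have "measure M {x \<in> space M. l (Suc n) < f x}
        \<le> (2 * exp 1 * (lam / \<kappa>) * ((k + h) / h) * a powr \<beta>)\<^sup>2 * a"
      using superlevel_decay[OF h kh(3) am small] by (simp add: kh)
    also have "\<dots> \<le> (2 * exp 1 * (lam / \<kappa>) * (8 / (1 / 2) ^ n) * a powr \<beta>)\<^sup>2 * a"
    proof (intro mult_right_mono power_mono mult_left_mono)
      have "l (Suc n) \<le> 2 * K" using K by (simp add: l_def)
      then have "(k + h) / h \<le> 2 * K / h"
        unfolding kh using h by (intro divide_right_mono) simp_all
      also have "\<dots> = 8 / (1 / 2) ^ n" using K by (simp add: h_def)
      finally show "(k + h) / h \<le> 8 / (1 / 2) ^ n" .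
      show "0 \<le> 2 * exp 1 * (lam / \<kappa>) * ((k + h) / h) * a powr \<beta>"
        using lam \<kappa> h kh(3) by simp
      show "0 \<le> a" using \<open>0 < b * r ^ n\<close> by (simp add: a_def)
    qed (use lam \<kappa> in auto)
    also have "2 * exp 1 * (lam / \<kappa>) * (8 / (1 / 2) ^ n) * a powr \<beta> = 32 * exp 1 * \<theta> / 2"
      unfolding ba using lam \<kappa> by (simp add: field_simps)
    also have "(32 * exp 1 * \<theta> / 2)\<^sup>2 * a = r / 4 * a"
      unfolding \<theta>32 by (simp add: r_def power2_eq_square powr_add[symmetric])
    also have "\<dots> \<le> r * (b * r ^ n)"
    proof -
      have "r / 4 * (2 * y) \<le> r * y" if "0 < y" for y using r that by simp
      then show ?thesis using \<open>0 < b * r ^ n\<close> unfolding a_def by blast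
    qed
    also have "\<dots> = b * r ^ Suc n" by simp
    finally show ?case .
  qed
  have "measure M {x \<in> space M. 2 * K < f x} \<le> 0"
  proof (rule tendsto_lowerbound)
    show "(\<lambda>n. b * r ^ n) \<longlonglongrightarrow> 0"
      using tendsto_mult_left[OF LIMSEQ_realpow_zero[of r], of b] r by simp
    show "\<forall>\<^sub>F n in sequentially. measure M {x \<in> space M. 2 * K < f x} \<le> b * r ^ n"
    proof (intro always_eventually allI)
      fix n
      have "(1 / 2) ^ n \<le> (1::real)" "(0::real) < (1 / 2) ^ n" by (simp_all add: power_le_one)
      then have l: "0 < l n" "l n \<le> 2 * K" using K by (simp_all add: l_def)
      have "measure M {x \<in> space M. 2 * K < f x} \<le> measure M {x \<in> space M. l n < f x}"
        using l by (intro measure_mono_fmeasurable superlevel_fmeasurable f f2) auto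
      also have "\<dots> \<le> b * r ^ n" by (rule level)
      finally show "measure M {x \<in> space M. 2 * K < f x} \<le> b * r ^ n" .
    qed
  qed simp
  then show ?thesis using measure_nonneg by (rule antisym)
qed

end

section \<open>The bound for the ground state\<close>

lemma positive_measure_superlevel:
  fixes \<phi> :: "'a::euclidean_space \<Rightarrow> real"
  assumes D: "open D" and \<phi>: "continuous_on D \<phi>" and x: "x \<in> D" "l < \<phi> x"
    and S: "S \<in> fmeasurable lborel" "\<And>y. y \<in> D \<Longrightarrow> l < \<phi> y \<Longrightarrow> y \<in> S"
  shows "0 < measure lborel S"
proof -
  have "open (D \<inter> \<phi> -` {l<..})"
    using \<phi> D open_greaterThan by (rule continuous_open_preimage)
  moreover have "x \<in> D \<inter> \<phi> -` {l<..}" using x by simp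
  ultimately obtain e where e: "0 < e" "ball x e \<subseteq> D \<inter> \<phi> -` {l<..}"
    by (rule openE)
  have "0 < measure lborel (ball x e)" using e(1) by simp
  also have "\<dots> \<le> measure lborel S"
    using e(2) S by (intro measure_mono_fmeasurable) auto
  finally show ?thesis .
qed

text \<open>The defining property of the Friedrichs extension is evaluated at a fixed test function \<open>g\<close>, which is
  approximated by the constant sequence.\<close>

lemma ground_state_form_limits:
  fixes \<phi> :: "'a::euclidean_space \<Rightarrow> real"
  assumes D: "open D" and gs: "ground_state \<alpha> D lam \<phi>"
  defines "f \<equiv> \<lambda>x. indicator D x * \<phi> x"
  obtains u where "\<And>n. u n \<in> test_functions D"
    and "(\<lambda>n. \<integral>x. (u n x - f x)\<^sup>2 \<partial>lborel) \<longlonglongrightarrow> 0"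
    and "\<And>e. 0 < e \<Longrightarrow> \<exists>N. \<forall>m\<ge>N. \<forall>n\<ge>N.
        dirichlet_form \<alpha> D (\<lambda>x. u m x - u n x) (\<lambda>x. u m x - u n x) < e"
    and "\<And>g. g \<in> test_functions D \<Longrightarrow>
        (\<lambda>n. dirichlet_form \<alpha> D (u n) g) \<longlonglongrightarrow> lam * (\<integral>x. f x * g x \<partial>lborel)"
proof -
  let ?A = "\<lambda>f x. - frac_laplacian \<alpha> f x * indicator D x"
  have [measurable]: "D \<in> sets borel" using D by simp
  have "(\<phi>, \<lambda>x. - (- lam * \<phi> x)) \<in> friedrichs_extension D (test_functions D) ?A"
    using gs by (simp add: ground_state_def eigenfunction_def dirichlet_frac_laplacian_def)
  then obtain u where u: "form_approx D (test_functions D) ?A u \<phi>"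
    and lim: "\<And>g v. g \<in> L2 D \<Longrightarrow> form_approx D (test_functions D) ?A v g \<Longrightarrow>
      (\<lambda>n. L2_inner D (?A (u n)) (v n)) \<longlonglongrightarrow> L2_inner D (\<lambda>x. - (- lam * \<phi> x)) g"
    by (auto simp: friedrichs_extension_def)
  have ut: "u n \<in> test_functions D" for n using u by (simp add: form_approx_def)
  show ?thesis
  proof (rule that[OF ut])
    have "L2_norm D (\<lambda>x. u n x - \<phi> x) = sqrt (\<integral>x. (u n x - f x)\<^sup>2 \<partial>lborel)" for n
    proof -
      have "indicator D x *\<^sub>R ((u n x - \<phi> x) * (u n x - \<phi> x)) = (u n x - f x)\<^sup>2" for x
        using test_functions_eq_0[OF ut, of x n] by (cases "x \<in> D") (simp_all add: f_def power2_eq_square)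
      then show ?thesis by (simp add: L2_norm_def L2_inner_def set_lebesgue_integral_def)
    qed
    then have "(\<lambda>n. sqrt (\<integral>x. (u n x - f x)\<^sup>2 \<partial>lborel)) \<longlonglongrightarrow> 0"
      using u by (simp add: form_approx_def)
    from tendsto_power[OF this, of 2]
    show "(\<lambda>n. \<integral>x. (u n x - f x)\<^sup>2 \<partial>lborel) \<longlonglongrightarrow> 0" by simp
    show "\<exists>N. \<forall>m\<ge>N. \<forall>n\<ge>N.
        dirichlet_form \<alpha> D (\<lambda>x. u m x - u n x) (\<lambda>x. u m x - u n x) < e" if "0 < e" for e
      using u that by (simp add: form_approx_def dirichlet_form_def)
    fix g
    assume g: "g \<in> test_functions D"
    note [measurable] = test_functions_measurable[OF g]
    have "(\<lambda>x. indicator D x *\<^sub>R (g x)\<^sup>2) = (\<lambda>x. (g x)\<^sup>2)"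
      using test_functions_eq_0[OF g] by (auto simp: indicator_def fun_eq_iff)
    then have "g \<in> L2 D"
      using test_functions_integrable(2)[OF g]
      unfolding L2_def set_borel_measurable_def set_integrable_def by simp
    moreover have "form_approx D (test_functions D) ?A (\<lambda>_. g) g"
      using g by (auto simp: form_approx_def L2_norm_def L2_inner_def)
    ultimately have "(\<lambda>n. dirichlet_form \<alpha> D (u n) g) \<longlonglongrightarrow> L2_inner D (\<lambda>x. - (- lam * \<phi> x)) g"
      unfolding dirichlet_form_def by (rule lim)
    also have "L2_inner D (\<lambda>x. - (- lam * \<phi> x)) g = (\<integral>x. lam * (f x * g x) \<partial>lborel)"
      unfolding L2_inner_def set_lebesgue_integral_def
      by (intro Bochner_Integration.integral_cong) (simp_all add: f_def)
    finally show "(\<lambda>n. dirichlet_form \<alpha> D (u n) g) \<longlonglongrightarrow> lam * (\<integral>x. f x * g x \<partial>lborel)"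
      by simp
  qed
qed

text \<open>Chebyshev's inequality with \<open>L2_norm D \<phi> = 1\<close> starts the iteration at the height \<open>K\<close>, chosen as the
  smallest one allowed by \<open>superlevel_null\<close>; it scales like \<open>lam powr (1 / (2 * \<beta>))\<close>. The resulting
  bound almost everywhere holds at every point of \<open>D\<close>, since \<open>\<phi>\<close> is continuous and \<open>D\<close> is open.\<close>

lemma ground_state_bound:
  fixes \<phi> :: "'a::euclidean_space \<Rightarrow> real"
  assumes \<alpha>: "0 < \<alpha>" "\<alpha> < 2" and D: "open D" and gs: "ground_state \<alpha> D lam \<phi>"
    and x: "x \<in> D"
  defines "\<beta> \<equiv> \<alpha> / DIM('a)"
  defines "P \<equiv> 2 powr - (1 / (2 * \<beta>)) / (32 * exp 1)
    * (frac_constant TYPE('a) \<alpha> / 4 * faber_krahn_constant TYPE('a) \<alpha>)"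
  shows "\<phi> x \<le> 2 * sqrt 2 * P powr - (1 / (2 * \<beta>)) * lam powr (1 / (2 * \<beta>))"
proof -
  let ?\<kappa> = "frac_constant TYPE('a) \<alpha> / 4 * faber_krahn_constant TYPE('a) \<alpha>"
  define f where "f = (\<lambda>x. indicator D x * \<phi> x)"
  have Dm [measurable]: "D \<in> sets borel" using D by simp
  have \<phi>: "\<phi> \<in> L2 D" "continuous_on D \<phi>" "\<And>x. x \<in> D \<Longrightarrow> 0 < \<phi> x" "L2_norm D \<phi> = 1"
    using gs by (auto simp: ground_state_def eigenfunction_def dirichlet_frac_laplacian_def
        friedrichs_extension_def)
  have f2eq: "indicator D x *\<^sub>R (\<phi> x)\<^sup>2 = (f x)\<^sup>2" for x
    by (simp add: f_def indicator_def)
  have L2: "(\<lambda>x. indicator D x *\<^sub>R \<phi> x) \<in> borel_measurable lborel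
      \<and> integrable lborel (\<lambda>x. (f x)\<^sup>2)"
    using \<phi>(1) unfolding L2_def set_borel_measurable_def set_integrable_def f2eq mem_Collect_eq .
  then have fm [measurable]: "f \<in> borel_measurable borel" by (simp add: f_def)
  note f2 = conjunct2[OF L2]
  have f1: "(\<integral>x. (f x)\<^sup>2 \<partial>lborel) = 1"
    using \<phi>(4) unfolding L2_norm_def L2_inner_def set_lebesgue_integral_def
      power2_eq_square[symmetric] f2eq by simp
  have f0: "0 \<le> f x" for x using \<phi>(3)[of x] by (cases "x \<in> D") (simp_all add: f_def)
  have \<omega>: "unit_ball_vol (real DIM('a)) > 0" by simp
  then have FK: "0 < faber_krahn_constant TYPE('a) \<alpha>"
    using less_imp_neq[OF \<omega>] by (auto simp: faber_krahn_constant_def)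
  have \<kappa>: "0 < ?\<kappa>" using FK frac_constant_pos[OF \<alpha>, where 'a='a] by simp
  have \<beta>: "0 < \<beta>" using \<alpha> by (simp add: \<beta>_def)
  have P: "0 < P" unfolding P_def by (rule mult_pos_pos[OF _ \<kappa>]) simp
  obtain u where u: "\<And>n. u n \<in> test_functions D"
    "(\<lambda>n. \<integral>x. (u n x - f x)\<^sup>2 \<partial>lborel) \<longlonglongrightarrow> 0"
    "\<And>e. 0 < e \<Longrightarrow> \<exists>N. \<forall>m\<ge>N. \<forall>n\<ge>N.
        dirichlet_form \<alpha> D (\<lambda>x. u m x - u n x) (\<lambda>x. u m x - u n x) < e"
    "\<And>g. g \<in> test_functions D \<Longrightarrow>
        (\<lambda>n. dirichlet_form \<alpha> D (u n) g) \<longlonglongrightarrow> lam * (\<integral>x. f x * g x \<partial>lborel)"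
    using ground_state_form_limits[OF D gs] unfolding f_def by blast
  have truncation: "?\<kappa> * a powr - \<beta> * (\<integral>x. (soft_cut h (f x - k))\<^sup>2 \<partial>lborel)
      \<le> lam * (\<integral>x. f x * soft_cut h (f x - k) \<partial>lborel)"
    if "0 < h" "h < k" "measure lborel {x. k - h < f x} < a" for h k a
    unfolding \<beta>_def by (rule eigenfunction_truncation_inequality[OF \<alpha> fm f2 u that])
  have level_fm: "{x. l < f x} \<in> fmeasurable lborel" if "0 < l" for l
    using superlevel_fmeasurable(1)[of f lborel l] f2 that by simp
  have below: "\<phi> y \<le> l" if "0 < l" "measure lborel {x. l < f x} = 0" "y \<in> D" for l y
  proof (rule ccontr)
    assume "\<not> \<phi> y \<le> l"
    then have "0 < measure lborel {x. l < f x}"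
      using D \<phi>(2) that level_fm[OF that(1)]
      by (intro positive_measure_superlevel[of D \<phi> y l]) (auto simp: f_def)
    then show False using that(2) by simp
  qed
  \<comment> \<open>Otherwise the truncation inequality makes every superlevel set of positive height null.\<close>
  have lam: "0 < lam"
  proof (rule ccontr)
    assume "\<not> 0 < lam"
    define h where "h = \<phi> x / 4"
    have h: "0 < h" using \<phi>(3)[OF x] by (simp add: h_def)
    define a where "a = measure lborel {x. 2 * h - h < f x} + 1"
    let ?F = "\<lambda>x. soft_cut h (f x - 2 * h)"
    have "0 < a" unfolding a_def by (rule add_nonneg_pos) simp_all
    have "?\<kappa> * a powr - \<beta> * (\<integral>x. (?F x)\<^sup>2 \<partial>lborel) \<le> lam * (\<integral>x. f x * ?F x \<partial>lborel)"
      by (rule truncation) (use h in \<open>simp_all add: a_def\<close>)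
    also have "\<dots> \<le> 0"
      using \<open>\<not> 0 < lam\<close> f0 soft_cut_nonneg[OF h]
      by (intro mult_nonpos_nonneg Bochner_Integration.integral_nonneg mult_nonneg_nonneg) auto
    finally have "?\<kappa> * a powr - \<beta> * (\<integral>x. (?F x)\<^sup>2 \<partial>lborel) \<le> 0" .
    moreover have "0 < ?\<kappa> * a powr - \<beta>" using \<open>0 < a\<close> by (intro mult_pos_pos[OF \<kappa>]) simp
    ultimately have "(\<integral>x. (?F x)\<^sup>2 \<partial>lborel) \<le> 0"
      using mult_pos_pos not_le by blast
    then have "(\<integral>x. (?F x)\<^sup>2 \<partial>lborel) = 0" by (intro antisym) simp_all
    then have "measure lborel {x. 2 * h + h < f x} \<le> 0"
      using superlevel_le_soft_cut[of h "2 * h" f lborel] h f2 by simp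
    then have "measure lborel {x. 3 * h < f x} = 0" by (simp add: measure_le_0_iff)
    from below[OF _ this x] h show False by (simp add: h_def)
  qed
  define K where "K = sqrt 2 * (lam / P) powr (1 / (2 * \<beta>))"
  have K: "0 < K" using lam P by (simp add: K_def)
  have "measure lborel {x \<in> space lborel. 2 * K < f x} = 0"
  proof (rule superlevel_null[OF _ f2 lam \<kappa> \<beta> _ K])
    show "f \<in> borel_measurable lborel" by simp
    have "K\<^sup>2 = 2 * (lam / P) powr (1 / \<beta>)"
    proof -
      have half: "1 / (2 * \<beta>) + 1 / (2 * \<beta>) = 1 / \<beta>" by simp
      have "((lam / P) powr (1 / (2 * \<beta>)))\<^sup>2 = (lam / P) powr (1 / \<beta>)"
        unfolding power2_eq_square powr_add[symmetric] half ..
      then show ?thesis by (simp add: K_def power_mult_distrib)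
    qed
    then have "2 * ((\<integral>x. (f x)\<^sup>2 \<partial>lborel) / K\<^sup>2) = 1 / (lam / P) powr (1 / \<beta>)"
      by (simp add: f1)
    also have "\<dots> = (P / lam) powr (1 / \<beta>)"
      using lam P by (simp add: powr_divide)
    finally show "2 * ((\<integral>x. (f x)\<^sup>2 \<partial>lborel) / K\<^sup>2)
        \<le> (2 powr - (1 / (2 * \<beta>)) / (32 * exp 1) * ?\<kappa> / lam) powr (1 / \<beta>)"
      by (simp add: P_def)
  qed (use truncation in simp)
  then have "\<phi> x \<le> 2 * K" using below[of "2 * K" x] K x by simp
  also have "2 * K = 2 * sqrt 2 * P powr - (1 / (2 * \<beta>)) * lam powr (1 / (2 * \<beta>))"
    using lam P by (simp add: K_def powr_divide powr_minus_divide)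
  finally show ?thesis .
qed

theorem theorem1:
  fixes \<alpha> :: real
  assumes "0 < \<alpha>" and "\<alpha> < 2"
  shows "\<exists>c>0. \<forall>(D :: 'a::euclidean_space set) lam \<phi>.
           open D \<longrightarrow> bounded D \<longrightarrow> D \<noteq> {} \<longrightarrow> ground_state \<alpha> D lam \<phi> \<longrightarrow>
             (SUP x\<in>D. ereal (\<phi> x)) \<le> ereal (c * lam powr (real DIM('a) / (2 * \<alpha>)))"
proof -
  define P where "P = 2 powr - (1 / (2 * (\<alpha> / DIM('a)))) / (32 * exp 1)
    * (frac_constant TYPE('a) \<alpha> / 4 * faber_krahn_constant TYPE('a) \<alpha>)"
  define c where "c = 2 * sqrt 2 * P powr - (1 / (2 * (\<alpha> / DIM('a))))"
  have \<omega>: "unit_ball_vol (real DIM('a)) > 0" by simp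
  have "0 < P"
    unfolding P_def faber_krahn_constant_def
    using frac_constant_pos[OF assms, where 'a='a] less_imp_neq[OF \<omega>] by (intro mult_pos_pos) auto
  then have "0 < c" by (simp add: c_def)
  moreover have "(SUP x\<in>D. ereal (\<phi> x)) \<le> ereal (c * lam powr (real DIM('a) / (2 * \<alpha>)))"
    if "open D" "ground_state \<alpha> D lam \<phi>" for D :: "'a set" and lam \<phi>
  proof (rule SUP_least)
    fix x assume "x \<in> D"
    from ground_state_bound[OF assms that this, folded P_def, folded c_def]
    show "ereal (\<phi> x) \<le> ereal (c * lam powr (real DIM('a) / (2 * \<alpha>)))" by simp
  qed
  ultimately show ?thesis by blast
qed

end
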